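(* An epigroup variety $\mathcal V$ is a lower-modular element of the lattice $\mathbf{EPI}$ if and only if $\mathcal V=\mathcal M\vee\mathcal N$ where $\mathcal M$ is one of the varieties $\mathcal T$ or $\mathcal{SL}$, while $\mathcal N$ is a $0$-reduced variety.
   Context: An epigroup is a semigroup $S$ such that for every $x\in S$ some power $x^n$ ($n\ge 1$) lies in a subgroup of $S$. For $x\in S$ some power of $x$ lies in a maximal subgroup $G_x$ of $S$; its unit is denoted $x^\omega$. Then $xx^\omega=x^\omega x\in G_x$, and the pseudoinverse $\overline{x}$ of $x$ is the inverse of $xx^\omega$ in $G_x$. Epigroups are considered as algebras with multiplication and the unary operation $x\mapsto\overline{x}$; an epigroup variety is a variety of such algebras consisting of epigroups. $\mathbf{EPI}$ is the lattice of all epigroup varieties under inclusion: $\wedge$ is intersection, and $\mathcal X\vee\mathcal Y$ is the least epigroup variety containing $\mathcal X$ and $\mathcal Y$. Periodic semigroup varieties are identified with periodic epigroup varieties (in periodic epigroups pseudoinversion is expressible through multiplication). The symbol $w=0$ abbreviates the pair of identities $wx=xw=w$ where $x$ is a letter not occurring in the word $w$; identities of the form $w=0$, and (epigroup) varieties given by such identities, are called $0$-reduced. $\mathcal T$ is the trivial variety, $\mathcal{SL}$ the variety of all semilattices. An element $x$ of a lattice $\langle L;\vee,\wedge\rangle$ is lower-modular if $(z\wedge y)\vee x=(z\vee x)\wedge y$ for all $y,z\in L$ with $x\le y$. *)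

theory Defs
  imports "HOL-Algebra.Lattice" "HOL-Algebra.Group" "HOL-Library.Infinite_Typeclass"
begin

section \<open>Epigroups\<close>

text \<open>No laws are built into this record; the operations are only relevant on the carrier.\<close>

record 'a unary_alg = "'a partial_object" +
  prd :: "'a \<Rightarrow> 'a \<Rightarrow> 'a" (infixl \<open>\<cdot>\<index>\<close> 70)
  bar :: "'a \<Rightarrow> 'a"

definition closed_alg :: "'a unary_alg \<Rightarrow> bool" where
  "closed_alg S \<longleftrightarrow>
     carrier S \<noteq> {} \<and>
     (\<forall>x\<in>carrier S. \<forall>y\<in>carrier S. x \<cdot>\<^bsub>S\<^esub> y \<in> carrier S) \<and>
     (\<forall>x\<in>carrier S. bar S x \<in> carrier S)"

definition is_semigroup :: "'a unary_alg \<Rightarrow> bool" where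
  "is_semigroup S \<longleftrightarrow>
     carrier S \<noteq> {} \<and>
     (\<forall>x\<in>carrier S. \<forall>y\<in>carrier S. x \<cdot>\<^bsub>S\<^esub> y \<in> carrier S) \<and>
     (\<forall>x\<in>carrier S. \<forall>y\<in>carrier S. \<forall>z\<in>carrier S.
        (x \<cdot>\<^bsub>S\<^esub> y) \<cdot>\<^bsub>S\<^esub> z = x \<cdot>\<^bsub>S\<^esub> (y \<cdot>\<^bsub>S\<^esub> z))"

text \<open>A semigroup has no zeroth powers: \<open>spow S x n\<close> is the power of \<open>x\<close> with exponent \<open>n + 1\<close>.\<close>

primrec spow :: "'a unary_alg \<Rightarrow> 'a \<Rightarrow> nat \<Rightarrow> 'a" where
  "spow S x 0 = x"
| "spow S x (Suc n) = spow S x n \<cdot>\<^bsub>S\<^esub> x"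

definition restr :: "'a unary_alg \<Rightarrow> 'a set \<Rightarrow> 'a \<Rightarrow> 'a monoid" where
  "restr S H e = \<lparr>carrier = H, mult = prd S, one = e\<rparr>"

text \<open>The unit \<open>e\<close> of a subgroup is an arbitrary idempotent of \<open>S\<close>; it is determined by \<open>H\<close>.\<close>

definition subgroup_in :: "'a unary_alg \<Rightarrow> 'a set \<Rightarrow> 'a \<Rightarrow> bool" where
  "subgroup_in S H e \<longleftrightarrow> H \<subseteq> carrier S \<and> group (restr S H e)"

definition maximal_subgroup_in :: "'a unary_alg \<Rightarrow> 'a set \<Rightarrow> 'a \<Rightarrow> bool" where
  "maximal_subgroup_in S G e \<longleftrightarrow>
     subgroup_in S G e \<and> (\<forall>H f. subgroup_in S H f \<and> G \<subseteq> H \<longrightarrow> H = G)"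

definition is_epigroup :: "'a unary_alg \<Rightarrow> bool" where
  "is_epigroup S \<longleftrightarrow>
     is_semigroup S \<and> (\<forall>x\<in>carrier S. \<exists>n H e. subgroup_in S H e \<and> spow S x n \<in> H)"

text \<open>In the next definition \<open>G\<close> is the maximal subgroup containing some power of \<open>x\<close>, and its
  unit \<open>e\<close> is \<open>x\<^sup>\<omega>\<close>.\<close>

definition is_pseudoinverse :: "'a unary_alg \<Rightarrow> 'a \<Rightarrow> 'a \<Rightarrow> bool" where
  "is_pseudoinverse S x y \<longleftrightarrow>
     (\<exists>G e. maximal_subgroup_in S G e \<and> (\<exists>n. spow S x n \<in> G) \<and>
            x \<cdot>\<^bsub>S\<^esub> e \<in> G \<and> y = inv\<^bsub>restr S G e\<^esub> (x \<cdot>\<^bsub>S\<^esub> e))"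

definition epigroup_alg :: "'a unary_alg \<Rightarrow> bool" where
  "epigroup_alg S \<longleftrightarrow> is_epigroup S \<and> (\<forall>x\<in>carrier S. is_pseudoinverse S x (bar S x))"


section \<open>Identities and varieties\<close>

text \<open>Words are terms in a countable alphabet; associativity is not built into them.\<close>

datatype uword = Letter nat | Prd uword uword | Bar uword

primrec letters :: "uword \<Rightarrow> nat set" where
  "letters (Letter i) = {i}"
| "letters (Prd u v) = letters u \<union> letters v"
| "letters (Bar u) = letters u"

primrec word_value :: "'a unary_alg \<Rightarrow> (nat \<Rightarrow> 'a) \<Rightarrow> uword \<Rightarrow> 'a" where
  "word_value S \<phi> (Letter i) = \<phi> i"
| "word_value S \<phi> (Prd u v) = word_value S \<phi> u \<cdot>\<^bsub>S\<^esub> word_value S \<phi> v"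
| "word_value S \<phi> (Bar u) = bar S (word_value S \<phi> u)"

definition satisfies :: "'a unary_alg \<Rightarrow> uword \<times> uword \<Rightarrow> bool" where
  "satisfies S p \<longleftrightarrow>
     (\<forall>\<phi>. range \<phi> \<subseteq> carrier S \<longrightarrow> word_value S \<phi> (fst p) = word_value S \<phi> (snd p))"

text \<open>A variety is represented by the set of its members whose carrier is a subset of a fixed type
  \<open>'a\<close>.  If \<open>'a\<close> is infinite, this loses nothing: a variety is generated by its free algebra of
  countable rank, which is countable, so it is determined by those members; and since
  being an epigroup with the given pseudoinversion is a property of one-generated subalgebras, it
  can be tested on them as well.\<close>

definition variety :: "'a unary_alg set \<Rightarrow> bool" where
  "variety V \<longleftrightarrow> (\<exists>\<Sigma>. V = {S. closed_alg S \<and> (\<forall>p\<in>\<Sigma>. satisfies S p)})"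

definition epigroup_variety :: "'a unary_alg set \<Rightarrow> bool" where
  "epigroup_variety V \<longleftrightarrow> variety V \<and> (\<forall>S\<in>V. epigroup_alg S)"

definition EPI :: "'a unary_alg set gorder" where
  "EPI = \<lparr>carrier = {V. epigroup_variety V}, eq = (=), le = (\<subseteq>)\<rparr>"

definition trivial_variety :: "'a unary_alg set" where
  "trivial_variety = {S. epigroup_alg S \<and> (\<exists>a. carrier S = {a})}"

definition semilattice_variety :: "'a unary_alg set" where
  "semilattice_variety =
     {S. epigroup_alg S \<and>
         (\<forall>x\<in>carrier S. x \<cdot>\<^bsub>S\<^esub> x = x) \<and>
         (\<forall>x\<in>carrier S. \<forall>y\<in>carrier S. x \<cdot>\<^bsub>S\<^esub> y = y \<cdot>\<^bsub>S\<^esub> x)}"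

definition zero_identities :: "uword \<Rightarrow> (uword \<times> uword) set" where
  "zero_identities w =
     (\<Union>i\<in>- letters w. {(Prd w (Letter i), w), (Prd (Letter i) w, w)})"

text \<open>The identities are imposed on epigroups, so the unary operation is pseudoinversion from the
  outset.  The class of epigroups defined by a set of identities need not be a variety (the class
  of all epigroups is not), hence the first conjunct.\<close>

definition zero_reduced_variety :: "'a unary_alg set \<Rightarrow> bool" where
  "zero_reduced_variety V \<longleftrightarrow>
     epigroup_variety V \<and>
     (\<exists>W. V = {S. epigroup_alg S \<and> (\<forall>w\<in>W. \<forall>p\<in>zero_identities w. satisfies S p)})"


section \<open>Lower-modular elements\<close>

definition lower_modular :: "('b, 'c) gorder_scheme \<Rightarrow> 'b \<Rightarrow> bool" where
  "lower_modular L x \<longleftrightarrow>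
     x \<in> carrier L \<and>
     (\<forall>y\<in>carrier L. \<forall>z\<in>carrier L.
        x \<sqsubseteq>\<^bsub>L\<^esub> y \<longrightarrow> (z \<sqinter>\<^bsub>L\<^esub> y) \<squnion>\<^bsub>L\<^esub> x = (z \<squnion>\<^bsub>L\<^esub> x) \<sqinter>\<^bsub>L\<^esub> y)"

end

theory Submission
  imports Defs "HOL-Library.Countable"
begin

text \<open>Since \<open>'a\<close> is infinite, it contains every relatively free algebra of countable rank, so a variety
  is determined by its equational theory, a fully invariant congruence on terms.  Epigroup varieties
  correspond to the theories that contain the axioms of a Drazin inverse of some bounded index.  The
  order is reversed, joins of varieties become intersections of theories, and meets become
  transitive closures of unions.  So lower modularity of a variety with theory \<open>X\<close> says that for
  \<open>Y \<subseteq> X\<close> and arbitrary \<open>Z\<close>, a chain of steps in \<open>Z\<close> and \<open>Y\<close> between two terms identified by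
  \<open>X\<close> can be replaced by one of steps in \<open>Z \<inter> X\<close> and \<open>Y\<close>.

  Sufficiency.  This property is inherited by intersections, so the two joinands can be treated
  separately.  In a 0-reduced variety all nontrivial identities are between words that vanish; hence
  a nontrivial step in \<open>Y\<close> starts and ends at vanishing words, and the steps in \<open>Z\<close> between them are
  identified by \<open>X\<close> anyway (\<open>upper_modular_zero_isolating\<close>).  For semilattices the chain has to be
  rerouted through words of constant content; this works because words that \<open>Z\<close> identifies with words
  of another content take their values in the minimal ideal, which is completely simple
  (\<open>upper_modular_content_theory\<close>).

  Necessity.  All information comes from chains \<open>u\<close>, \<open>q\<close>, \<open>r\<close>, \<open>v\<close> with steps in \<open>Z\<close>, \<open>Y\<close>, \<open>Z\<close>,
  where \<open>Y\<close> is chosen so that \<open>u\<close> is alone in its class modulo \<open>Y\<close>: then some nontrivial step in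
  \<open>Z \<inter> X\<close> must leave \<open>u\<close>, and if \<open>Z\<close> relates \<open>u\<close> to few words, this is a new identity of the variety.
  With nil theories for \<open>Z\<close>, semigroup words that are equal in the variety to terms with
  pseudoinversion become equal to one another (\<open>upper_modular_merges\<close>).  Two instances of this force
  idempotents to be central and pseudoinversion to be \<open>x \<mapsto> x\<^sup>\<omega>\<close>, so that terms with
  pseudoinversion take values in a semilattice of central idempotents.  With the theory of a group
  that distinguishes all semigroup words for \<open>Z\<close>, both sides of a nontrivial identity between
  semigroup words become equal to such terms (\<open>upper_modular_nontrivial_identity\<close>).  Hence \<open>X\<close>
  identifies two different words only if both are idempotent, and it identifies idempotent words
  either always or exactly when they have the same letters.\<close>


section \<open>Fully invariant congruences and their models\<close>

primrec subst :: "(nat \<Rightarrow> uword) \<Rightarrow> uword \<Rightarrow> uword" where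
  "subst \<sigma> (Letter i) = \<sigma> i"
| "subst \<sigma> (Prd u v) = Prd (subst \<sigma> u) (subst \<sigma> v)"
| "subst \<sigma> (Bar u) = Bar (subst \<sigma> u)"

definition fully_invariant :: "(uword \<times> uword) set \<Rightarrow> bool" where
  "fully_invariant \<theta> \<longleftrightarrow>
     equiv UNIV \<theta> \<and>
     (\<forall>u u' v v'. (u, u') \<in> \<theta> \<longrightarrow> (v, v') \<in> \<theta> \<longrightarrow> (Prd u v, Prd u' v') \<in> \<theta>) \<and>
     (\<forall>u u'. (u, u') \<in> \<theta> \<longrightarrow> (Bar u, Bar u') \<in> \<theta>) \<and>
     (\<forall>\<sigma> u u'. (u, u') \<in> \<theta> \<longrightarrow> (subst \<sigma> u, subst \<sigma> u') \<in> \<theta>)"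

definition models :: "(uword \<times> uword) set \<Rightarrow> 'a unary_alg set" where
  "models \<Sigma> = {S. closed_alg S \<and> (\<forall>p\<in>\<Sigma>. satisfies S p)}"

definition theory_of :: "'a unary_alg set \<Rightarrow> (uword \<times> uword) set" where
  "theory_of V = {p. \<forall>S\<in>V. satisfies S p}"

lemma fully_invariant_refl: "fully_invariant \<theta> \<Longrightarrow> (u, u) \<in> \<theta>"
  by (meson UNIV_I equivE fully_invariant_def refl_onD)

lemma fully_invariant_sym: "fully_invariant \<theta> \<Longrightarrow> (u, v) \<in> \<theta> \<Longrightarrow> (v, u) \<in> \<theta>"
  by (meson equivE fully_invariant_def symD)

lemma fully_invariant_trans:
  "fully_invariant \<theta> \<Longrightarrow> (u, v) \<in> \<theta> \<Longrightarrow> (v, w) \<in> \<theta> \<Longrightarrow> (u, w) \<in> \<theta>"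
  by (meson fully_invariant_def equivE transD)

lemma fully_invariant_Prd:
  "fully_invariant \<theta> \<Longrightarrow> (u, u') \<in> \<theta> \<Longrightarrow> (v, v') \<in> \<theta> \<Longrightarrow> (Prd u v, Prd u' v') \<in> \<theta>"
  unfolding fully_invariant_def by blast

lemma fully_invariant_Bar: "fully_invariant \<theta> \<Longrightarrow> (u, u') \<in> \<theta> \<Longrightarrow> (Bar u, Bar u') \<in> \<theta>"
  unfolding fully_invariant_def by blast

lemma fully_invariant_subst:
  "fully_invariant \<theta> \<Longrightarrow> (u, u') \<in> \<theta> \<Longrightarrow> (subst \<sigma> u, subst \<sigma> u') \<in> \<theta>"
  unfolding fully_invariant_def by blast

lemma fully_invariantI:
  assumes "\<And>u. (u, u) \<in> \<theta>"
    and "\<And>u v. (u, v) \<in> \<theta> \<Longrightarrow> (v, u) \<in> \<theta>"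
    and "\<And>u v w. (u, v) \<in> \<theta> \<Longrightarrow> (v, w) \<in> \<theta> \<Longrightarrow> (u, w) \<in> \<theta>"
    and "\<And>u u' v. (u, u') \<in> \<theta> \<Longrightarrow> (Prd u v, Prd u' v) \<in> \<theta>"
    and "\<And>u u' v. (u, u') \<in> \<theta> \<Longrightarrow> (Prd v u, Prd v u') \<in> \<theta>"
    and "\<And>u u'. (u, u') \<in> \<theta> \<Longrightarrow> (Bar u, Bar u') \<in> \<theta>"
    and "\<And>\<sigma> u u'. (u, u') \<in> \<theta> \<Longrightarrow> (subst \<sigma> u, subst \<sigma> u') \<in> \<theta>"
  shows "fully_invariant \<theta>"
proof -
  have "equiv UNIV \<theta>"
    unfolding equiv_def by (intro conjI reflI symI transI) (simp, (fact assms)+)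
  moreover have "(Prd u v, Prd u' v') \<in> \<theta>" if "(u, u') \<in> \<theta>" "(v, v') \<in> \<theta>" for u u' v v'
    using assms(3-5) that by blast
  ultimately show ?thesis
    unfolding fully_invariant_def using assms(6,7) by blast
qed

lemma fully_invariant_UNIV: "fully_invariant UNIV"
  by (rule fully_invariantI) auto

lemma fully_invariant_Int:
  assumes "fully_invariant \<theta>" "fully_invariant \<eta>"
  shows "fully_invariant (\<theta> \<inter> \<eta>)"
proof (rule fully_invariantI)
  show "(u, w) \<in> \<theta> \<inter> \<eta>" if "(u, v) \<in> \<theta> \<inter> \<eta>" "(v, w) \<in> \<theta> \<inter> \<eta>" for u v w
    using that assms by (meson IntD1 IntD2 IntI fully_invariant_trans)
qed (use assms in \<open>auto intro: fully_invariant_refl fully_invariant_sym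
       fully_invariant_Prd fully_invariant_Bar fully_invariant_subst\<close>)

text \<open>The join of two fully invariant congruences in the lattice of all equivalence relations is
  already a fully invariant congruence, so joins can be analysed through finite chains of steps.\<close>

lemma fully_invariant_join:
  assumes "fully_invariant \<theta>" "fully_invariant \<eta>"
  shows "fully_invariant ((\<theta> \<union> \<eta>)\<^sup>+)"
proof (rule fully_invariantI)
  have lift: "(f u, f v) \<in> (\<theta> \<union> \<eta>)\<^sup>+"
    if "(u, v) \<in> (\<theta> \<union> \<eta>)\<^sup>+" "\<And>u v. (u, v) \<in> \<theta> \<union> \<eta> \<Longrightarrow> (f u, f v) \<in> \<theta> \<union> \<eta>" for f u v
    using that(1) by (induction rule: trancl_induct) (meson that(2) r_into_trancl trancl_into_trancl)+
  show "(u, u) \<in> (\<theta> \<union> \<eta>)\<^sup>+" for u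
    using fully_invariant_refl[OF assms(1)] by blast
  have "sym (\<theta> \<union> \<eta>)"
    using assms by (auto intro!: symI dest: fully_invariant_sym)
  then show "(v, u) \<in> (\<theta> \<union> \<eta>)\<^sup>+" if "(u, v) \<in> (\<theta> \<union> \<eta>)\<^sup>+" for u v
    using that by (meson sym_trancl symD)
  show "(u, w) \<in> (\<theta> \<union> \<eta>)\<^sup>+" if "(u, v) \<in> (\<theta> \<union> \<eta>)\<^sup>+" "(v, w) \<in> (\<theta> \<union> \<eta>)\<^sup>+" for u v w
    using that by (rule trancl_trans)
  show "(Prd u v, Prd u' v) \<in> (\<theta> \<union> \<eta>)\<^sup>+" if "(u, u') \<in> (\<theta> \<union> \<eta>)\<^sup>+" for u u' v
    using lift[OF that, of "\<lambda>u. Prd u v"] assms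
    by (auto intro: fully_invariant_refl fully_invariant_Prd)
  show "(Prd v u, Prd v u') \<in> (\<theta> \<union> \<eta>)\<^sup>+" if "(u, u') \<in> (\<theta> \<union> \<eta>)\<^sup>+" for u u' v
    using lift[OF that, of "\<lambda>u. Prd v u"] assms
    by (auto intro: fully_invariant_refl fully_invariant_Prd)
  show "(Bar u, Bar u') \<in> (\<theta> \<union> \<eta>)\<^sup>+" if "(u, u') \<in> (\<theta> \<union> \<eta>)\<^sup>+" for u u'
    using lift[OF that, of Bar] assms by (auto intro: fully_invariant_Bar)
  show "(subst \<sigma> u, subst \<sigma> u') \<in> (\<theta> \<union> \<eta>)\<^sup>+" if "(u, u') \<in> (\<theta> \<union> \<eta>)\<^sup>+" for \<sigma> u u'
    using lift[OF that, of "subst \<sigma>"] assms by (auto intro: fully_invariant_subst)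
qed

lemma join_least:
  assumes "fully_invariant \<rho>" "\<theta> \<subseteq> \<rho>" "\<eta> \<subseteq> \<rho>"
  shows "(\<theta> \<union> \<eta>)\<^sup>+ \<subseteq> \<rho>"
proof -
  have "trans \<rho>"
    using assms(1) by (simp add: fully_invariant_def equiv_def)
  then have "\<rho>\<^sup>+ = \<rho>"
    by (rule trancl_id)
  then show ?thesis
    using trancl_mono_subset[of "\<theta> \<union> \<eta>" \<rho>] assms(2,3) by auto
qed

lemma word_value_closed:
  assumes "closed_alg S" "range \<phi> \<subseteq> carrier S"
  shows "word_value S \<phi> u \<in> carrier S"
  using assms by (induction u) (auto simp: closed_alg_def)

lemma word_value_cong:
  assumes "\<And>i. i \<in> letters u \<Longrightarrow> \<phi> i = \<psi> i"
  shows "word_value S \<phi> u = word_value S \<psi> u"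
  using assms by (induction u) auto

lemma word_value_subst:
  "word_value S \<phi> (subst \<sigma> u) = word_value S (\<lambda>i. word_value S \<phi> (\<sigma> i)) u"
  by (induction u) auto

lemma finite_letters: "finite (letters u)"
  by (induction u) auto

lemma letters_nonempty: "letters u \<noteq> {}"
  by (induction u) auto

lemma letters_subst: "letters (subst \<sigma> u) = (\<Union>i\<in>letters u. letters (\<sigma> i))"
  by (induction u) auto

lemma satisfiesD:
  "satisfies S (u, v) \<Longrightarrow> range \<phi> \<subseteq> carrier S \<Longrightarrow> word_value S \<phi> u = word_value S \<phi> v"
  by (simp add: satisfies_def)

lemma fully_invariant_theory_of:
  assumes "\<And>S. S \<in> V \<Longrightarrow> closed_alg S"
  shows "fully_invariant (theory_of V)"
proof (rule fully_invariantI)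
  show "(subst \<sigma> u, subst \<sigma> u') \<in> theory_of V" if "(u, u') \<in> theory_of V" for \<sigma> u u'
    unfolding theory_of_def mem_Collect_eq satisfies_def fst_conv snd_conv
  proof (intro ballI allI impI)
    fix S and \<phi> :: "nat \<Rightarrow> 'a"
    assume S: "S \<in> V" and \<phi>: "range \<phi> \<subseteq> carrier S"
    have "range (\<lambda>i. word_value S \<phi> (\<sigma> i)) \<subseteq> carrier S"
      using word_value_closed[OF assms[OF S] \<phi>] by blast
    then show "word_value S \<phi> (subst \<sigma> u) = word_value S \<phi> (subst \<sigma> u')"
      using that S by (simp add: word_value_subst theory_of_def satisfies_def)
  qed
qed (auto simp: theory_of_def satisfies_def)

instance uword :: countable
  by countable_datatype

text \<open>There are only countably many terms, so representatives of the congruence classes can be coded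
  by elements of any infinite type.\<close>

lemma free_algebra_exists:
  assumes "fully_invariant \<theta>"
  obtains S :: "'a::infinite unary_alg" and \<phi> where
    "S \<in> models \<theta>" "range \<phi> \<subseteq> carrier S"
    "\<And>u v. word_value S \<phi> u = word_value S \<phi> v \<longleftrightarrow> (u, v) \<in> \<theta>"
proof -
  note fi = assms
  obtain f :: "nat \<Rightarrow> 'a" where f: "inj f"
    using infinite_countable_subset infinite_UNIV by blast
  define rep where "rep u = (SOME v. (u, v) \<in> \<theta>)" for u
  have rep: "(u, rep u) \<in> \<theta>" for u
    unfolding rep_def by (rule someI) (rule fully_invariant_refl[OF fi])
  have rep_eq: "rep u = rep v \<longleftrightarrow> (u, v) \<in> \<theta>" for u v
  proof
    assume "rep u = rep v"
    then show "(u, v) \<in> \<theta>"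
      using rep[of u] rep[of v] fi by (metis fully_invariant_sym fully_invariant_trans)
  next
    assume "(u, v) \<in> \<theta>"
    then have "(u, w) \<in> \<theta> \<longleftrightarrow> (v, w) \<in> \<theta>" for w
      using fi by (meson fully_invariant_sym fully_invariant_trans)
    then show "rep u = rep v"
      by (simp add: rep_def)
  qed
  define g where "g u = f (to_nat u)" for u :: uword
  have g: "inj g"
    unfolding g_def using f inj_to_nat by (metis injD injI)
  define h where "h u = g (rep u)" for u
  have h_eq: "h u = h v \<longleftrightarrow> (u, v) \<in> \<theta>" for u v
    using g rep_eq by (auto simp: h_def inj_eq)
  have inv_h: "(the_inv g (h u), u) \<in> \<theta>" for u
    using rep[of u] fi g by (auto simp: h_def the_inv_f_f intro: fully_invariant_sym)
  define S where "S = \<lparr>carrier = range h, prd = (\<lambda>a b. h (Prd (the_inv g a) (the_inv g b))),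
    bar = (\<lambda>a. h (Bar (the_inv g a)))\<rparr>"
  have prd: "h u \<cdot>\<^bsub>S\<^esub> h v = h (Prd u v)" for u v
    using inv_h fi by (simp add: S_def h_eq fully_invariant_Prd)
  have bar: "bar S (h u) = h (Bar u)" for u
    using inv_h fi by (simp add: S_def h_eq fully_invariant_Bar)
  have carrier: "carrier S = range h"
    by (simp add: S_def)
  have val: "word_value S (\<lambda>i. h (\<sigma> i)) u = h (subst \<sigma> u)" for \<sigma> u
    by (induction u) (auto simp: prd bar)
  have "closed_alg S"
    unfolding closed_alg_def carrier using prd bar by auto
  moreover have "satisfies S (u, v)" if uv: "(u, v) \<in> \<theta>" for u v
    unfolding satisfies_def fst_conv snd_conv
  proof (intro allI impI)
    fix \<phi> :: "nat \<Rightarrow> 'a" assume "range \<phi> \<subseteq> carrier S"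
    then have "\<forall>i. \<exists>w. \<phi> i = h w"
      by (auto simp: carrier)
    then obtain \<sigma> where "\<phi> = (\<lambda>i. h (\<sigma> i))"
      by metis
    then show "word_value S \<phi> u = word_value S \<phi> v"
      using fully_invariant_subst[OF fi uv] by (simp add: val h_eq)
  qed
  ultimately have "S \<in> models \<theta>"
    by (auto simp: models_def)
  moreover have "range (\<lambda>i. h (Letter i)) \<subseteq> carrier S"
    by (auto simp: carrier)
  moreover have "subst Letter u = u" for u
    by (induction u) auto
  then have "word_value S (\<lambda>i. h (Letter i)) u = word_value S (\<lambda>i. h (Letter i)) v \<longleftrightarrow> (u, v) \<in> \<theta>"
    for u v by (simp add: val h_eq)
  ultimately show thesis
    using that by blast
qed

lemma theory_of_models:
  assumes "fully_invariant \<theta>"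
  shows "theory_of (models \<theta> :: 'a::infinite unary_alg set) = \<theta>"
proof
  show "\<theta> \<subseteq> theory_of (models \<theta> :: 'a unary_alg set)"
    by (auto simp: theory_of_def models_def)
  obtain S :: "'a unary_alg" and \<phi> where S: "S \<in> models \<theta>" "range \<phi> \<subseteq> carrier S"
    "\<And>u v. word_value S \<phi> u = word_value S \<phi> v \<longleftrightarrow> (u, v) \<in> \<theta>"
    using free_algebra_exists[OF assms] by blast
  then show "theory_of (models \<theta> :: 'a unary_alg set) \<subseteq> \<theta>"
    by (fastforce simp: theory_of_def satisfies_def)
qed

lemma in_theory_if_models_satisfy:
  assumes "fully_invariant \<theta>"
    and "\<And>(S :: nat unary_alg) \<phi>. S \<in> models \<theta> \<Longrightarrow> range \<phi> \<subseteq> carrier S \<Longrightarrow>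
           word_value S \<phi> u = word_value S \<phi> v"
  shows "(u, v) \<in> \<theta>"
proof -
  have "(u, v) \<in> theory_of (models \<theta> :: nat unary_alg set)"
    using assms(2) by (auto simp: theory_of_def satisfies_def)
  then show ?thesis
    by (simp add: theory_of_models[OF assms(1)])
qed

lemma models_satisfy: "S \<in> models \<Sigma> \<Longrightarrow> (u, v) \<in> \<Sigma> \<Longrightarrow> satisfies S (u, v)"
  by (auto simp: models_def)

lemma models_antimono: "\<Sigma> \<subseteq> \<Sigma>' \<Longrightarrow> models \<Sigma>' \<subseteq> models \<Sigma>"
  by (auto simp: models_def)

lemma variety_models: "variety (models \<Sigma>)"
  by (auto simp: variety_def models_def)

lemma variety_eq_models_theory_of:
  assumes "variety V"
  shows "V = models (theory_of V)"
  using assms by (auto simp: variety_def models_def theory_of_def)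

lemma models_subset_iff:
  assumes "fully_invariant \<theta>" "fully_invariant \<eta>"
  shows "(models \<theta> :: 'a::infinite unary_alg set) \<subseteq> models \<eta> \<longleftrightarrow> \<eta> \<subseteq> \<theta>"
proof
  assume "(models \<theta> :: 'a unary_alg set) \<subseteq> models \<eta>"
  then have "theory_of (models \<eta> :: 'a unary_alg set) \<subseteq> theory_of (models \<theta> :: 'a unary_alg set)"
    by (auto simp: theory_of_def)
  then show "\<eta> \<subseteq> \<theta>"
    by (simp add: theory_of_models assms)
qed (auto simp: models_def)

lemma models_eq_iff:
  assumes "fully_invariant \<theta>" "fully_invariant \<eta>"
  shows "(models \<theta> :: 'a::infinite unary_alg set) = models \<eta> \<longleftrightarrow> \<theta> = \<eta>"
  using models_subset_iff[OF assms] models_subset_iff[OF assms(2,1)] by blast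

section \<open>Epigroups as algebras with a Drazin inverse\<close>

locale carrier_semigroup =
  fixes S :: "'b unary_alg" (structure)
  assumes prd_closed: "x \<in> carrier S \<Longrightarrow> y \<in> carrier S \<Longrightarrow> x \<cdot> y \<in> carrier S"
    and assoc: "x \<in> carrier S \<Longrightarrow> y \<in> carrier S \<Longrightarrow> z \<in> carrier S \<Longrightarrow> (x \<cdot> y) \<cdot> z = x \<cdot> (y \<cdot> z)"
begin

lemma spow_closed: "x \<in> carrier S \<Longrightarrow> spow S x n \<in> carrier S"
  by (induction n) (auto intro: prd_closed)

lemma spow_commutes:
  assumes "x \<in> carrier S" "y \<in> carrier S" "x \<cdot> y = y \<cdot> x"
  shows "spow S x n \<cdot> y = y \<cdot> spow S x n"
proof (induction n)
  case (Suc n)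
  have "spow S x (Suc n) \<cdot> y = spow S x n \<cdot> (y \<cdot> x)"
    using assms by (simp add: assoc spow_closed)
  also have "\<dots> = y \<cdot> spow S x (Suc n)"
    using assms Suc by (simp add: assoc[symmetric] spow_closed)
  finally show ?case .
qed (use assms in simp)

lemma spow_mult:
  assumes "x \<in> carrier S" "y \<in> carrier S" "x \<cdot> y = y \<cdot> x"
  shows "spow S (x \<cdot> y) n = spow S x n \<cdot> spow S y n"
proof (induction n)
  case (Suc n)
  have "spow S (x \<cdot> y) (Suc n) = spow S x n \<cdot> ((spow S y n \<cdot> x) \<cdot> y)"
    using assms Suc by (simp add: assoc spow_closed prd_closed)
  also have "spow S y n \<cdot> x = x \<cdot> spow S y n"
    using assms by (intro spow_commutes) auto
  finally show ?case
    using assms by (simp add: assoc spow_closed prd_closed)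
qed simp

lemma spow_idempotent:
  assumes "e \<cdot> e = e"
  shows "spow S e n = e"
  using assms by (induction n) auto

text \<open>The largest subgroup with unit \<open>e\<close> is the group of units of the local monoid \<open>eSe\<close>.\<close>

definition local_units :: "'b \<Rightarrow> 'b set" where
  "local_units e = {g \<in> carrier S. e \<cdot> g = g \<and> g \<cdot> e = g \<and>
     (\<exists>h\<in>carrier S. e \<cdot> h = h \<and> h \<cdot> e = h \<and> g \<cdot> h = e \<and> h \<cdot> g = e)}"

lemma group_local_units:
  assumes e: "e \<in> carrier S" "e \<cdot> e = e"
  shows "group (restr S (local_units e) e)"
proof (rule groupI)
  fix x y assume "x \<in> carrier (restr S (local_units e) e)" "y \<in> carrier (restr S (local_units e) e)"
  then obtain x' y' where
    x: "x \<in> carrier S" "x' \<in> carrier S" "e \<cdot> x = x" "x \<cdot> e = x" "e \<cdot> x' = x'" "x' \<cdot> e = x'"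
       "x \<cdot> x' = e" "x' \<cdot> x = e" and
    y: "y \<in> carrier S" "y' \<in> carrier S" "e \<cdot> y = y" "y \<cdot> e = y" "e \<cdot> y' = y'" "y' \<cdot> e = y'"
       "y \<cdot> y' = e" "y' \<cdot> y = e"
    by (auto simp: restr_def local_units_def)
  have "(x \<cdot> y) \<cdot> (y' \<cdot> x') = x \<cdot> ((y \<cdot> y') \<cdot> x')" "(y' \<cdot> x') \<cdot> (x \<cdot> y) = y' \<cdot> ((x' \<cdot> x) \<cdot> y)"
    using x(1,2) y(1,2) by (simp_all add: assoc prd_closed)
  then have "(x \<cdot> y) \<cdot> (y' \<cdot> x') = e" "(y' \<cdot> x') \<cdot> (x \<cdot> y) = e"
    using x y by auto
  moreover have "e \<cdot> (x \<cdot> y) = x \<cdot> y" "(x \<cdot> y) \<cdot> e = x \<cdot> y"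
      "e \<cdot> (y' \<cdot> x') = y' \<cdot> x'" "(y' \<cdot> x') \<cdot> e = y' \<cdot> x'"
    using x(1,2) y(1,2) e(1) by (metis assoc x y)+
  ultimately have "x \<cdot> y \<in> local_units e"
    using x(1,2) y(1,2) by (auto simp: local_units_def prd_closed)
  then show "x \<otimes>\<^bsub>restr S (local_units e) e\<^esub> y \<in> carrier (restr S (local_units e) e)"
    by (simp add: restr_def)
next
  fix x assume "x \<in> carrier (restr S (local_units e) e)"
  then show "\<exists>y\<in>carrier (restr S (local_units e) e). y \<otimes>\<^bsub>restr S (local_units e) e\<^esub> x = \<one>\<^bsub>restr S (local_units e) e\<^esub>"
    by (auto simp: restr_def local_units_def)
qed (use e in \<open>auto simp: restr_def local_units_def assoc\<close>)

lemma subgroup_in_subset_local_units: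
  assumes "subgroup_in S H e"
  shows "H \<subseteq> local_units e"
proof
  fix h assume h: "h \<in> H"
  interpret G: group "restr S H e"
    using assms by (simp add: subgroup_in_def)
  have "H \<subseteq> carrier S"
    using assms by (simp add: subgroup_in_def)
  then show "h \<in> local_units e"
    using h G.l_one[of h] G.r_one[of h] G.inv_closed[of h] G.l_inv[of h] G.r_inv[of h]
      G.l_one[of "inv\<^bsub>restr S H e\<^esub> h"] G.r_one[of "inv\<^bsub>restr S H e\<^esub> h"]
    by (auto simp: restr_def local_units_def)
qed

lemma maximal_subgroup_local_units:
  assumes e: "e \<in> carrier S" "e \<cdot> e = e"
  shows "maximal_subgroup_in S (local_units e) e"
  unfolding maximal_subgroup_in_def
proof (intro conjI allI impI)
  show "subgroup_in S (local_units e) e"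
    using group_local_units[OF e] by (auto simp: subgroup_in_def local_units_def)
  fix H f assume H: "subgroup_in S H f \<and> local_units e \<subseteq> H"
  interpret G: group "restr S H f"
    using H by (simp add: subgroup_in_def)
  have "e \<in> local_units e"
    using e by (auto simp: local_units_def)
  then have "e \<in> H"
    using H by blast
  then have "e = f"
    using G.l_cancel_one[of e e] e by (simp add: restr_def)
  then show "H = local_units e"
    using subgroup_in_subset_local_units[of H f] H by auto
qed

end

text \<open>These axioms of the Drazin inverse turn out to describe pseudoinversion in epigroups.  They are
  equational except for the exponent in \<open>index\<close>, which may depend on the element.\<close>

locale drazin_algebra = carrier_semigroup S for S :: "'b unary_alg" (structure) +
  assumes nonempty: "carrier S \<noteq> {}"
    and bar_closed: "x \<in> carrier S \<Longrightarrow> bar S x \<in> carrier S"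
    and bar_commute: "x \<in> carrier S \<Longrightarrow> x \<cdot> bar S x = bar S x \<cdot> x"
    and bar_reflexive: "x \<in> carrier S \<Longrightarrow> (bar S x \<cdot> x) \<cdot> bar S x = bar S x"
    and index: "x \<in> carrier S \<Longrightarrow> \<exists>n. spow S x n = (spow S x n \<cdot> x) \<cdot> bar S x"
begin

definition omega :: "'b \<Rightarrow> 'b" where
  "omega x = x \<cdot> bar S x"

lemma omega_closed: "x \<in> carrier S \<Longrightarrow> omega x \<in> carrier S"
  by (simp add: omega_def prd_closed bar_closed)

lemma omega_idempotent: "x \<in> carrier S \<Longrightarrow> omega x \<cdot> omega x = omega x"
  by (simp add: omega_def bar_commute[symmetric] bar_closed prd_closed assoc)
     (metis assoc bar_closed bar_reflexive prd_closed)

lemma bar_omega: "x \<in> carrier S \<Longrightarrow> bar S x \<cdot> omega x = bar S x"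
  by (simp add: omega_def assoc[symmetric] bar_closed bar_reflexive)

lemma omega_bar: "x \<in> carrier S \<Longrightarrow> omega x \<cdot> bar S x = bar S x"
  by (simp add: omega_def bar_commute bar_reflexive)

lemma omega_commute: "x \<in> carrier S \<Longrightarrow> omega x \<cdot> x = x \<cdot> omega x"
  by (metis assoc bar_closed bar_commute omega_def)

lemma spow_omega_iff:
  assumes "x \<in> carrier S"
  shows "spow S x n = (spow S x n \<cdot> x) \<cdot> bar S x \<longleftrightarrow> spow S x n \<cdot> omega x = spow S x n"
  using assms by (auto simp: omega_def assoc spow_closed bar_closed)

lemma index_mono:
  assumes x: "x \<in> carrier S" and "spow S x n \<cdot> omega x = spow S x n" and "n \<le> m"
  shows "spow S x m \<cdot> omega x = spow S x m"
  using assms(3,2)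
proof (induction rule: dec_induct)
  case (step k)
  have "spow S x (Suc k) \<cdot> omega x = spow S x k \<cdot> (omega x \<cdot> x)"
    using x by (simp add: assoc spow_closed omega_closed omega_commute)
  also have "\<dots> = spow S x (Suc k)"
    using x step by (simp add: assoc[symmetric] spow_closed omega_closed)
  finally show ?case .
qed

lemma spow_bar: "x \<in> carrier S \<Longrightarrow> spow S x n \<cdot> spow S (bar S x) n = omega x"
  by (metis bar_closed bar_commute omega_def omega_idempotent spow_idempotent spow_mult)

lemma closed_alg: "closed_alg S"
  using nonempty by (simp add: closed_alg_def prd_closed bar_closed)

text \<open>For \<open>e = omega x\<close> the group of units of \<open>eSe\<close> contains a power of \<open>x\<close> and \<open>xe\<close>, whose inverse in
  it is \<open>bar S x\<close>.\<close>

lemma epigroup_alg: "epigroup_alg S"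
proof -
  have *: "\<exists>n. spow S x n \<in> local_units (omega x)" "x \<cdot> omega x \<in> local_units (omega x)"
      "inv\<^bsub>restr S (local_units (omega x)) (omega x)\<^esub> (x \<cdot> omega x) = bar S x"
    if x: "x \<in> carrier S" for x
  proof -
    let ?e = "omega x"
    note c = x omega_closed[OF x] bar_closed[OF x] spow_closed[OF x]
    obtain n where n: "spow S x n \<cdot> ?e = spow S x n"
      using index[OF x] spow_omega_iff[OF x] by blast
    have "?e \<cdot> spow S x n = spow S x n"
      using spow_commutes[of x ?e n] n c omega_commute[OF x] by simp
    moreover have "spow S (bar S x) n \<cdot> ?e = spow S (bar S x) n" "?e \<cdot> spow S (bar S x) n = spow S (bar S x) n"
    proof -
      have e: "spow S ?e n = ?e"
        using omega_idempotent[OF x] by (rule spow_idempotent)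
      have "bar S x \<cdot> ?e = ?e \<cdot> bar S x"
        by (simp add: bar_omega omega_bar x)
      then show "spow S (bar S x) n \<cdot> ?e = spow S (bar S x) n"
          "?e \<cdot> spow S (bar S x) n = spow S (bar S x) n"
        using spow_mult[of "bar S x" ?e n] spow_commutes[of "bar S x" ?e n] c e
        by (simp_all add: bar_omega x)
    qed
    moreover have "spow S (bar S x) n \<cdot> spow S x n = ?e"
      using spow_mult[of "bar S x" x n] spow_bar[OF x, of n] c bar_commute[OF x]
        spow_mult[of x "bar S x" n] by simp
    ultimately show "\<exists>n. spow S x n \<in> local_units ?e"
      using n spow_bar[OF x, of n] c spow_closed[OF bar_closed[OF x]] unfolding local_units_def by blast
    have xe: "?e \<cdot> (x \<cdot> ?e) = x \<cdot> ?e" "(x \<cdot> ?e) \<cdot> ?e = x \<cdot> ?e"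
      using c omega_idempotent[OF x] by (metis assoc omega_commute)+
    have "(x \<cdot> ?e) \<cdot> bar S x = x \<cdot> (?e \<cdot> bar S x)" "bar S x \<cdot> (x \<cdot> ?e) = (bar S x \<cdot> x) \<cdot> ?e"
      using c by (simp_all add: assoc)
    moreover have "bar S x \<cdot> x = ?e" "x \<cdot> bar S x = ?e"
      using bar_commute[OF x] by (simp_all add: omega_def)
    ultimately have inv: "(x \<cdot> ?e) \<cdot> bar S x = ?e" "bar S x \<cdot> (x \<cdot> ?e) = ?e"
      using omega_idempotent[OF x] omega_bar[OF x] by simp_all
    from this show u: "x \<cdot> ?e \<in> local_units ?e"
      using xe c bar_omega[OF x] omega_bar[OF x] prd_closed unfolding local_units_def by blast
    have bu: "bar S x \<in> local_units ?e"
      using inv xe c bar_omega[OF x] omega_bar[OF x] prd_closed unfolding local_units_def by blast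
    interpret G: group "restr S (local_units ?e) ?e"
      using c omega_idempotent[OF x] by (intro group_local_units)
    show "inv\<^bsub>restr S (local_units ?e) ?e\<^esub> (x \<cdot> ?e) = bar S x"
      using u bu inv by (intro G.inv_equality) (auto simp: restr_def)
  qed
  have max: "maximal_subgroup_in S (local_units (omega x)) (omega x)" if "x \<in> carrier S" for x
    using that by (intro maximal_subgroup_local_units omega_closed omega_idempotent)
  have "is_semigroup S"
    using nonempty prd_closed assoc by (auto simp: is_semigroup_def)
  moreover have "\<exists>n H e. subgroup_in S H e \<and> spow S x n \<in> H" if "x \<in> carrier S" for x
    using *(1)[OF that] max[OF that] unfolding maximal_subgroup_in_def by blast
  moreover have "is_pseudoinverse S x (bar S x)" if "x \<in> carrier S" for x
    unfolding is_pseudoinverse_def using *[OF that] max[OF that] by metis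
  ultimately show ?thesis
    unfolding epigroup_alg_def is_epigroup_def by blast
qed

end

lemma epigroup_alg_imp_drazin:
  fixes S :: "'b unary_alg" (structure)
  assumes "epigroup_alg S"
  shows "drazin_algebra S"
proof -
  interpret carrier_semigroup S
    using assms by unfold_locales (auto simp: epigroup_alg_def is_epigroup_def is_semigroup_def)
  have *: "bar S x \<in> carrier S \<and> x \<cdot> bar S x = bar S x \<cdot> x \<and> (bar S x \<cdot> x) \<cdot> bar S x = bar S x \<and>
      (\<exists>n. spow S x n = (spow S x n \<cdot> x) \<cdot> bar S x)" if x: "x \<in> carrier S" for x
  proof -
    obtain G e n where G: "subgroup_in S G e" and p: "spow S x n \<in> G" and xe: "x \<cdot> e \<in> G"
      and bar: "bar S x = inv\<^bsub>restr S G e\<^esub> (x \<cdot> e)"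
      using assms x unfolding epigroup_alg_def is_pseudoinverse_def maximal_subgroup_in_def by metis
    interpret G: group "restr S G e"
      using G by (simp add: subgroup_in_def)
    have sub: "G \<subseteq> carrier S"
      using G by (simp add: subgroup_in_def)
    have [simp]: "carrier (restr S G e) = G" "\<And>a b. a \<otimes>\<^bsub>restr S G e\<^esub> b = a \<cdot> b" "\<one>\<^bsub>restr S G e\<^esub> = e"
      by (simp_all add: restr_def)
    have unit: "e \<cdot> g = g" "g \<cdot> e = g" if "g \<in> G" for g
      using G.l_one[of g] G.r_one[of g] that by simp_all
    have e: "e \<in> carrier S"
      using G.one_closed sub by auto
    let ?p = "spow S x n"
    obtain q where q: "q \<in> G" "q \<cdot> ?p = e"
      using G.l_inv_ex[of ?p] p by auto
    note c = x e spow_closed[OF x, of n] subsetD[OF sub q(1)]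
    \<comment> \<open>The unit is a product of a power of \<open>x\<close> and its group inverse, hence commutes with \<open>x\<close>.\<close>
    have ex: "e \<cdot> x = x \<cdot> e"
    proof -
      have "e \<cdot> x = q \<cdot> (?p \<cdot> x)"
        using q c by (metis assoc)
      also have "?p \<cdot> x = x \<cdot> ?p"
        using x by (intro spow_commutes) auto
      also have "\<dots> = (x \<cdot> ?p) \<cdot> e"
        using unit(2)[OF p] c by (metis assoc)
      also have "q \<cdot> \<dots> = (q \<cdot> (?p \<cdot> x)) \<cdot> e"
        using spow_commutes[of x x n] c by (simp add: assoc prd_closed)
      also have "\<dots> = e \<cdot> (x \<cdot> e)"
        using q c by (metis assoc prd_closed)
      finally show ?thesis
        using unit(1)[OF xe] by simp
    qed
    have b: "bar S x \<in> G" "bar S x \<cdot> (x \<cdot> e) = e" "(x \<cdot> e) \<cdot> bar S x = e"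
      using G.inv_closed[of "x \<cdot> e"] G.l_inv[of "x \<cdot> e"] G.r_inv[of "x \<cdot> e"] xe bar by simp_all
    have bc: "bar S x \<in> carrier S"
      using b sub by blast
    have xb: "x \<cdot> bar S x = e"
      using b(3) c bc unit(1)[OF b(1)] by (simp add: assoc)
    have bx: "bar S x \<cdot> x = e"
      using b(2) c bc unit(2)[OF b(1)] ex by (metis assoc)
    show ?thesis
      using xb bx bc unit(1)[OF b(1)] unit(2)[OF p] c by (auto simp: assoc intro!: exI[of _ n])
  qed
  have "carrier S \<noteq> {}"
    using assms by (simp add: epigroup_alg_def is_epigroup_def is_semigroup_def)
  then show ?thesis
    using * by unfold_locales blast+
qed

lemma epigroup_alg_iff_drazin: "epigroup_alg S \<longleftrightarrow> drazin_algebra S"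
  using epigroup_alg_imp_drazin drazin_algebra.epigroup_alg by blast

section \<open>The lattice of epigroup varieties as a lattice of theories\<close>

primrec wpow :: "uword \<Rightarrow> nat \<Rightarrow> uword" where
  "wpow u 0 = u"
| "wpow u (Suc n) = Prd (wpow u n) u"

text \<open>The axioms of a Drazin inverse with an exponent that is common to all elements.\<close>

definition drazin_ids :: "nat \<Rightarrow> (uword \<times> uword) set" where
  "drazin_ids m = (let x = Letter 0; y = Letter 1; z = Letter 2 in
     {(Prd (Prd x y) z, Prd x (Prd y z)),
      (Prd x (Bar x), Prd (Bar x) x),
      (Prd (Prd (Bar x) x) (Bar x), Bar x),
      (wpow x m, Prd (Prd (wpow x m) x) (Bar x))})"

definition epi_theory :: "(uword \<times> uword) set \<Rightarrow> bool" where
  "epi_theory \<theta> \<longleftrightarrow> fully_invariant \<theta> \<and> (\<exists>m. drazin_ids m \<subseteq> \<theta>)"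

lemma epi_theory_fully_invariant: "epi_theory \<theta> \<Longrightarrow> fully_invariant \<theta>"
  by (simp add: epi_theory_def)

lemma word_value_wpow: "word_value S \<phi> (wpow u n) = spow S (word_value S \<phi> u) n"
  by (induction n) auto

lemma drazin_if_satisfies:
  fixes S :: "'b unary_alg" (structure)
  assumes closed: "closed_alg S" and sat: "\<And>p. p \<in> drazin_ids m \<Longrightarrow> satisfies S p"
  shows "drazin_algebra S"
    and "x \<in> carrier S \<Longrightarrow> spow S x m \<cdot> drazin_algebra.omega S x = spow S x m"
proof -
  have val: "word_value S (\<lambda>i. if i = 0 then x else if i = 1 then y else z) u =
      word_value S (\<lambda>i. if i = 0 then x else if i = 1 then y else z) v"
    if "(u, v) \<in> drazin_ids m" "x \<in> carrier S" "y \<in> carrier S" "z \<in> carrier S" for u v x y z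
    using that by (intro satisfiesD[OF sat]) auto
  have ids: "spow S x m = (spow S x m \<cdot> x) \<cdot> bar S x" "x \<cdot> bar S x = bar S x \<cdot> x"
      "(bar S x \<cdot> x) \<cdot> bar S x = bar S x" if "x \<in> carrier S" for x
    using val[of "wpow (Letter 0) m" "Prd (Prd (wpow (Letter 0) m) (Letter 0)) (Bar (Letter 0))" x x x]
      val[of "Prd (Letter 0) (Bar (Letter 0))" "Prd (Bar (Letter 0)) (Letter 0)" x x x]
      val[of "Prd (Prd (Bar (Letter 0)) (Letter 0)) (Bar (Letter 0))" "Bar (Letter 0)" x x x] that
    by (auto simp: drazin_ids_def Let_def word_value_wpow)
  have assoc: "(x \<cdot> y) \<cdot> z = x \<cdot> (y \<cdot> z)" if "x \<in> carrier S" "y \<in> carrier S" "z \<in> carrier S" for x y z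
    using val[of "Prd (Prd (Letter 0) (Letter 1)) (Letter 2)" "Prd (Letter 0) (Prd (Letter 1) (Letter 2))" x y z]
      that by (auto simp: drazin_ids_def Let_def)
  show S: "drazin_algebra S"
    using closed ids assoc unfolding closed_alg_def by unfold_locales blast+
  show "spow S x m \<cdot> drazin_algebra.omega S x = spow S x m" if "x \<in> carrier S"
    using ids(1)[OF that] drazin_algebra.spow_omega_iff[OF S that] by simp
qed

lemma (in drazin_algebra) satisfies_drazin_ids:
  assumes "\<And>x. x \<in> carrier S \<Longrightarrow> spow S x m \<cdot> omega x = spow S x m" and "p \<in> drazin_ids m"
  shows "satisfies S p"
  unfolding satisfies_def
proof (intro allI impI)
  fix \<phi> :: "nat \<Rightarrow> 'b" assume "range \<phi> \<subseteq> carrier S"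
  then have "\<phi> i \<in> carrier S" for i
    by blast
  note \<phi> = this
  have "spow S (\<phi> 0) m = (spow S (\<phi> 0) m \<cdot> \<phi> 0) \<cdot> bar S (\<phi> 0)"
    using assms(1) \<phi> spow_omega_iff by blast
  then show "word_value S \<phi> (fst p) = word_value S \<phi> (snd p)"
    using assms(2) assoc[OF \<phi> \<phi> \<phi>] bar_commute[OF \<phi>] bar_reflexive[OF \<phi>]
    by (auto simp: drazin_ids_def Let_def word_value_wpow)
qed

lemma models_epi_theory_drazin:
  assumes "epi_theory \<theta>" "S \<in> models \<theta>"
  shows "drazin_algebra S"
proof -
  obtain m where "drazin_ids m \<subseteq> \<theta>"
    using assms by (auto simp: epi_theory_def)
  then show ?thesis
    using assms(2) drazin_if_satisfies(1)[of S m] by (auto simp: models_def)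
qed

lemma drazin_ids_mono:
  assumes fi: "fully_invariant \<theta>" and m: "drazin_ids m \<subseteq> \<theta>" and "m \<le> k"
  shows "drazin_ids k \<subseteq> \<theta>"
proof
  fix p assume p: "p \<in> drazin_ids k"
  have "satisfies S p" if S: "S \<in> models \<theta>" for S :: "nat unary_alg"
  proof -
    have sat: "closed_alg S" "\<And>p. p \<in> drazin_ids m \<Longrightarrow> satisfies S p"
      using S m by (auto simp: models_def)
    interpret drazin_algebra S
      using sat by (rule drazin_if_satisfies)
    show ?thesis
      using satisfies_drazin_ids[OF index_mono[OF _ drazin_if_satisfies(2)[OF sat] \<open>m \<le> k\<close>] p] by blast
  qed
  then have "p \<in> theory_of (models \<theta> :: nat unary_alg set)"
    by (auto simp: theory_of_def)
  then show "p \<in> \<theta>"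
    by (simp add: theory_of_models fi)
qed

lemma epi_theory_mono: "epi_theory \<theta> \<Longrightarrow> \<theta> \<subseteq> \<eta> \<Longrightarrow> fully_invariant \<eta> \<Longrightarrow> epi_theory \<eta>"
  by (auto simp: epi_theory_def)

lemma epi_theory_Int:
  assumes "epi_theory \<theta>" "epi_theory \<eta>"
  shows "epi_theory (\<theta> \<inter> \<eta>)"
proof -
  obtain m k where mk: "drazin_ids m \<subseteq> \<theta>" "drazin_ids k \<subseteq> \<eta>"
    using assms by (auto simp: epi_theory_def)
  then have "drazin_ids (max m k) \<subseteq> \<theta>" "drazin_ids (max m k) \<subseteq> \<eta>"
    using assms drazin_ids_mono unfolding epi_theory_def by (meson max.cobounded1 max.cobounded2)+
  then show ?thesis
    using assms fully_invariant_Int unfolding epi_theory_def by blast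
qed

lemma epi_theory_join: "epi_theory \<theta> \<Longrightarrow> epi_theory \<eta> \<Longrightarrow> epi_theory ((\<theta> \<union> \<eta>)\<^sup>+)"
  by (rule epi_theory_mono[of \<theta>]) (auto simp: epi_theory_def intro: fully_invariant_join)

lemma epi_theory_UNIV: "epi_theory UNIV"
  by (simp add: epi_theory_def fully_invariant_UNIV)

lemma epigroup_variety_models:
  assumes "epi_theory \<theta>"
  shows "epigroup_variety (models \<theta>)"
  using assms models_epi_theory_drazin
  by (auto simp: epigroup_variety_def variety_models epigroup_alg_iff_drazin)

text \<open>A free generator of the relatively free algebra has some index, and an identity that holds for a
  free generator holds throughout the variety; so the indices are bounded.\<close>

lemma epigroup_variety_theory:
  fixes V :: "'a::infinite unary_alg set"
  assumes V: "epigroup_variety V"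
  obtains \<theta> where "epi_theory \<theta>" "V = models \<theta>"
proof
  let ?\<theta> = "theory_of V"
  show V_eq: "V = models ?\<theta>"
    using V by (intro variety_eq_models_theory_of) (simp add: epigroup_variety_def)
  have dr: "drazin_algebra S" if "S \<in> V" for S
    using V that by (simp add: epigroup_variety_def epigroup_alg_iff_drazin)
  have fi: "fully_invariant ?\<theta>"
    using dr drazin_algebra.closed_alg by (blast intro: fully_invariant_theory_of)
  obtain F :: "'a unary_alg" and \<phi> where F: "F \<in> models ?\<theta>" "range \<phi> \<subseteq> carrier F"
    "\<And>u v. word_value F \<phi> u = word_value F \<phi> v \<longleftrightarrow> (u, v) \<in> ?\<theta>"
    using free_algebra_exists[OF fi] by metis
  interpret F: drazin_algebra F
    using F(1) V_eq dr by blast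
  have \<phi>: "\<phi> i \<in> carrier F" for i
    using F(2) by blast
  obtain m where "spow F (\<phi> 0) m = (spow F (\<phi> 0) m \<cdot>\<^bsub>F\<^esub> \<phi> 0) \<cdot>\<^bsub>F\<^esub> bar F (\<phi> 0)"
    using F.index \<phi> by blast
  then have "drazin_ids m \<subseteq> ?\<theta>"
    using \<phi> F.assoc F.bar_commute F.bar_reflexive
    by (auto simp: drazin_ids_def Let_def word_value_wpow simp flip: F(3))
  then show "epi_theory ?\<theta>"
    using fi by (auto simp: epi_theory_def)
qed

lemma join_EPI:
  assumes "epi_theory \<theta>" "epi_theory \<eta>"
  shows "(models \<theta> :: 'a::infinite unary_alg set) \<squnion>\<^bsub>EPI\<^esub> models \<eta> = models (\<theta> \<inter> \<eta>)"
proof -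
  let ?U = "Upper EPI {models \<theta> :: 'a unary_alg set, models \<eta>}"
  have U: "?U = {W. epigroup_variety W \<and> models \<theta> \<subseteq> W \<and> models \<eta> \<subseteq> W}"
    using assms epigroup_variety_models by (auto simp: Upper_def EPI_def)
  have least: "least EPI (models (\<theta> \<inter> \<eta>)) ?U"
    unfolding least_def
  proof (intro conjI ballI)
    show "models (\<theta> \<inter> \<eta>) \<in> ?U"
      unfolding U using epigroup_variety_models[OF epi_theory_Int[OF assms]]
      by (simp add: models_antimono)
    fix W assume W: "W \<in> ?U"
    obtain \<rho> where \<rho>: "epi_theory \<rho>" "W = models \<rho>"
      using W epigroup_variety_theory unfolding U by blast
    then have "\<rho> \<subseteq> \<theta> \<inter> \<eta>"
      using W assms unfolding U by (simp add: models_subset_iff epi_theory_fully_invariant)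
    then show "models (\<theta> \<inter> \<eta>) \<sqsubseteq>\<^bsub>EPI\<^esub> W"
      using \<rho> by (simp add: EPI_def models_antimono)
  qed (auto simp: EPI_def Upper_def)
  have uniq: "x = y" if "least EPI x ?U" "least EPI y ?U" for x y :: "'a unary_alg set"
    using that by (auto simp: least_def EPI_def)
  then show ?thesis
    unfolding join_def sup_def by (intro some_equality least uniq) assumption+
qed

lemma meet_EPI:
  assumes "epi_theory \<theta>" "epi_theory \<eta>"
  shows "(models \<theta> :: 'a::infinite unary_alg set) \<sqinter>\<^bsub>EPI\<^esub> models \<eta> = models ((\<theta> \<union> \<eta>)\<^sup>+)"
proof -
  let ?L = "Lower EPI {models \<theta> :: 'a unary_alg set, models \<eta>}"
  have L: "?L = {W. epigroup_variety W \<and> W \<subseteq> models \<theta> \<and> W \<subseteq> models \<eta>}"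
    using assms epigroup_variety_models by (auto simp: Lower_def EPI_def)
  have greatest: "greatest EPI (models ((\<theta> \<union> \<eta>)\<^sup>+)) ?L"
    unfolding greatest_def
  proof (intro conjI ballI)
    have "models ((\<theta> \<union> \<eta>)\<^sup>+) \<subseteq> (models \<theta> :: 'a unary_alg set)"
        "models ((\<theta> \<union> \<eta>)\<^sup>+) \<subseteq> (models \<eta> :: 'a unary_alg set)"
      by (auto intro!: models_antimono)
    then show "models ((\<theta> \<union> \<eta>)\<^sup>+) \<in> ?L"
      unfolding L using epigroup_variety_models[OF epi_theory_join[OF assms]] by simp
    fix W assume W: "W \<in> ?L"
    obtain \<rho> where \<rho>: "epi_theory \<rho>" "W = models \<rho>"
      using W epigroup_variety_theory unfolding L by blast
    then have "(\<theta> \<union> \<eta>)\<^sup>+ \<subseteq> \<rho>"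
      using W assms unfolding L
      by (intro join_least) (simp_all add: models_subset_iff epi_theory_fully_invariant)
    then show "W \<sqsubseteq>\<^bsub>EPI\<^esub> models ((\<theta> \<union> \<eta>)\<^sup>+)"
      using \<rho> by (simp add: EPI_def models_antimono)
  qed (auto simp: EPI_def Lower_def)
  have uniq: "x = y" if "greatest EPI x ?L" "greatest EPI y ?L" for x y :: "'a unary_alg set"
    using that by (auto simp: greatest_def EPI_def)
  then show ?thesis
    unfolding meet_def inf_def by (intro some_equality greatest uniq) assumption+
qed

text \<open>Lower modularity of the variety, read in the dual lattice of theories.  Only one inclusion is
  required because the other one holds whenever \<open>Y \<subseteq> X\<close>.\<close>

definition upper_modular_theory :: "(uword \<times> uword) set \<Rightarrow> bool" where
  "upper_modular_theory X \<longleftrightarrow> epi_theory X \<and>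
     (\<forall>Y Z. epi_theory Y \<longrightarrow> epi_theory Z \<longrightarrow> Y \<subseteq> X \<longrightarrow>
        (Z \<union> Y)\<^sup>+ \<inter> X \<subseteq> ((Z \<inter> X) \<union> Y)\<^sup>+)"

lemma upper_modularD:
  "upper_modular_theory X \<Longrightarrow> epi_theory Y \<Longrightarrow> epi_theory Z \<Longrightarrow> Y \<subseteq> X \<Longrightarrow>
     (u, v) \<in> (Z \<union> Y)\<^sup>+ \<Longrightarrow> (u, v) \<in> X \<Longrightarrow> (u, v) \<in> ((Z \<inter> X) \<union> Y)\<^sup>+"
  unfolding upper_modular_theory_def by blast

text \<open>Modularity of \<open>X\<close> is applied to \<open>Z\<close>, and then modularity of \<open>X'\<close> to \<open>Z \<inter> X\<close>.\<close>

lemma upper_modular_theory_Int: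
  assumes "upper_modular_theory X" "upper_modular_theory X'"
  shows "upper_modular_theory (X \<inter> X')"
  unfolding upper_modular_theory_def
proof (intro conjI allI impI subsetI)
  show "epi_theory (X \<inter> X')"
    using assms epi_theory_Int by (auto simp: upper_modular_theory_def)
  fix Y Z p assume Y: "epi_theory Y" "Y \<subseteq> X \<inter> X'" and Z: "epi_theory Z"
    and p: "p \<in> (Z \<union> Y)\<^sup>+ \<inter> (X \<inter> X')"
  have "p \<in> ((Z \<inter> X) \<union> Y)\<^sup>+"
    using assms(1) Y Z p unfolding upper_modular_theory_def by blast
  moreover have "epi_theory (Z \<inter> X)"
    using assms Z epi_theory_Int by (auto simp: upper_modular_theory_def)
  ultimately have "p \<in> ((Z \<inter> X \<inter> X') \<union> Y)\<^sup>+"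
    using assms(2) Y p unfolding upper_modular_theory_def by blast
  then show "p \<in> ((Z \<inter> (X \<inter> X')) \<union> Y)\<^sup>+"
    by (simp add: Int_assoc)
qed

lemma lower_modular_EPI_iff:
  assumes "epi_theory X"
  shows "lower_modular EPI (models X :: 'a::infinite unary_alg set) \<longleftrightarrow> upper_modular_theory X"
proof -
  have carrier: "carrier EPI = {models \<theta> :: 'a unary_alg set | \<theta>. epi_theory \<theta>}"
    using epigroup_variety_theory epigroup_variety_models
    unfolding EPI_def by simp blast
  have iff: "((models X :: 'a unary_alg set) \<sqsubseteq>\<^bsub>EPI\<^esub> models Y \<longrightarrow>
      (models Z \<sqinter>\<^bsub>EPI\<^esub> models Y) \<squnion>\<^bsub>EPI\<^esub> models X =
      (models Z \<squnion>\<^bsub>EPI\<^esub> models X) \<sqinter>\<^bsub>EPI\<^esub> (models Y :: 'a unary_alg set)) \<longleftrightarrow>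
      (Y \<subseteq> X \<longrightarrow> (Z \<union> Y)\<^sup>+ \<inter> X \<subseteq> ((Z \<inter> X) \<union> Y)\<^sup>+)"
    if YZ: "epi_theory Y" "epi_theory Z" for Y Z
  proof -
    have "(models X :: 'a unary_alg set) \<sqsubseteq>\<^bsub>EPI\<^esub> models Y \<longleftrightarrow> Y \<subseteq> X"
      using models_subset_iff[of X Y] assms YZ by (simp add: EPI_def epi_theory_fully_invariant)
    moreover have "(models Z \<sqinter>\<^bsub>EPI\<^esub> models Y) \<squnion>\<^bsub>EPI\<^esub> models X =
        (models ((Z \<union> Y)\<^sup>+ \<inter> X) :: 'a unary_alg set)"
      using assms YZ by (simp add: meet_EPI join_EPI epi_theory_join)
    moreover have "(models Z \<squnion>\<^bsub>EPI\<^esub> models X) \<sqinter>\<^bsub>EPI\<^esub> models Y =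
        (models (((Z \<inter> X) \<union> Y)\<^sup>+) :: 'a unary_alg set)"
      using assms YZ by (simp add: meet_EPI join_EPI epi_theory_Int)
    moreover have "(models ((Z \<union> Y)\<^sup>+ \<inter> X) :: 'a unary_alg set) = models (((Z \<inter> X) \<union> Y)\<^sup>+) \<longleftrightarrow>
        (Z \<union> Y)\<^sup>+ \<inter> X = ((Z \<inter> X) \<union> Y)\<^sup>+"
      using assms YZ
      by (intro models_eq_iff epi_theory_fully_invariant epi_theory_Int epi_theory_join)
    moreover have "((Z \<inter> X) \<union> Y)\<^sup>+ \<subseteq> (Z \<union> Y)\<^sup>+ \<inter> X" if "Y \<subseteq> X"
    proof (rule join_least)
      show "fully_invariant ((Z \<union> Y)\<^sup>+ \<inter> X)"
        using assms YZ by (intro epi_theory_fully_invariant epi_theory_Int epi_theory_join)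
    qed (use that in auto)
    ultimately show ?thesis
      by (metis order_refl subset_antisym)
  qed
  have "lower_modular EPI (models X :: 'a unary_alg set) \<longleftrightarrow>
      (\<forall>Y Z. epi_theory Y \<longrightarrow> epi_theory Z \<longrightarrow> (models X :: 'a unary_alg set) \<sqsubseteq>\<^bsub>EPI\<^esub> models Y \<longrightarrow>
         (models Z \<sqinter>\<^bsub>EPI\<^esub> models Y) \<squnion>\<^bsub>EPI\<^esub> models X =
         (models Z \<squnion>\<^bsub>EPI\<^esub> models X) \<sqinter>\<^bsub>EPI\<^esub> (models Y :: 'a unary_alg set))"
    unfolding lower_modular_def carrier using assms by auto
  also have "\<dots> \<longleftrightarrow> upper_modular_theory X"
    unfolding upper_modular_theory_def using iff assms by simp
  finally show ?thesis .
qed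

section \<open>Semilattices and neutrality of content\<close>

definition content_theory :: "(uword \<times> uword) set" where
  "content_theory = {(u, v). letters u = letters v}"

context drazin_algebra
begin

lemma word_value_closed': "range \<phi> \<subseteq> carrier S \<Longrightarrow> word_value S \<phi> u \<in> carrier S"
  by (rule word_value_closed[OF closed_alg])

lemma bar_idempotent:
  assumes "e \<in> carrier S" "e \<cdot> e = e"
  shows "bar S e = e"
proof -
  obtain n where "spow S e n = (spow S e n \<cdot> e) \<cdot> bar S e"
    using index assms(1) by blast
  then have "e \<cdot> bar S e = e"
    using assms by (simp add: spow_idempotent)
  then show ?thesis
    using bar_reflexive[OF assms(1)] bar_commute[OF assms(1)] by simp
qed

lemma omega_of_idempotent: "e \<in> carrier S \<Longrightarrow> e \<cdot> e = e \<Longrightarrow> omega e = e"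
  by (simp add: omega_def bar_idempotent)

lemma word_value_idempotent:
  assumes "e \<in> carrier S" "e \<cdot> e = e" "\<And>i. i \<in> letters u \<Longrightarrow> \<phi> i = e"
  shows "word_value S \<phi> u = e"
  using assms(3) by (induction u) (auto simp: assms bar_idempotent)

end

lemma fully_invariant_content_theory: "fully_invariant content_theory"
  by (rule fully_invariantI) (auto simp: content_theory_def letters_subst)

lemma epi_theory_content_theory: "epi_theory content_theory"
  unfolding epi_theory_def
proof (intro conjI exI[of _ 0])
  show "drazin_ids 0 \<subseteq> content_theory"
    by (auto simp: drazin_ids_def Let_def content_theory_def)
qed (rule fully_invariant_content_theory)

lemma trivial_variety_eq_models: "trivial_variety = models UNIV"
proof (intro equalityI subsetI)
  fix S :: "'a unary_alg" assume S: "S \<in> trivial_variety"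
  then obtain a where a: "carrier S = {a}" and "drazin_algebra S"
    by (auto simp: trivial_variety_def epigroup_alg_iff_drazin)
  then have cl: "closed_alg S"
    by (simp add: drazin_algebra.closed_alg)
  have "word_value S \<phi> u = a" if "range \<phi> \<subseteq> carrier S" for \<phi> u
    using word_value_closed[OF cl that] a by auto
  then show "S \<in> models UNIV"
    using cl by (auto simp: models_def satisfies_def)
next
  fix S :: "'a unary_alg" assume S: "S \<in> models UNIV"
  then interpret drazin_algebra S
    by (rule models_epi_theory_drazin[OF epi_theory_UNIV])
  have "x = y" if "x \<in> carrier S" "y \<in> carrier S" for x y
    using satisfiesD[OF models_satisfy[OF S UNIV_I], of "\<lambda>i. if i = 0 then x else y" "Letter 0" "Letter 1"]
      that by auto
  then have "\<exists>a. carrier S = {a}"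
    using nonempty by blast
  then show "S \<in> trivial_variety"
    by (simp add: trivial_variety_def epigroup_alg)
qed

text \<open>In a semilattice pseudoinversion is the identity map, so the value of a word is the meet of the
  values of its letters.\<close>

lemma semilattice_variety_eq_models: "semilattice_variety = models content_theory"
proof (intro equalityI subsetI)
  fix S :: "'a unary_alg" assume "S \<in> semilattice_variety"
  then have dr: "drazin_algebra S" and idem: "\<And>x. x \<in> carrier S \<Longrightarrow> x \<cdot>\<^bsub>S\<^esub> x = x"
    and comm: "\<And>x y. x \<in> carrier S \<Longrightarrow> y \<in> carrier S \<Longrightarrow> x \<cdot>\<^bsub>S\<^esub> y = y \<cdot>\<^bsub>S\<^esub> x"
    by (auto simp: semilattice_variety_def epigroup_alg_iff_drazin)
  interpret drazin_algebra S
    by (rule dr)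
  have absorb: "a \<cdot>\<^bsub>S\<^esub> word_value S \<phi> u = a"
    if "range \<phi> \<subseteq> carrier S" "a \<in> carrier S" "\<And>i. i \<in> letters u \<Longrightarrow> a \<cdot>\<^bsub>S\<^esub> \<phi> i = a" for a \<phi> u
    using that(3)
    by (induction u)
       (auto simp: bar_idempotent idem word_value_closed' that simp flip: assoc)
  have below: "word_value S \<phi> u \<cdot>\<^bsub>S\<^esub> \<phi> i = word_value S \<phi> u"
    if \<phi>: "range \<phi> \<subseteq> carrier S" and "i \<in> letters u" for \<phi> u i
  proof -
    have i: "\<phi> i \<in> carrier S"
      using \<phi> by blast
    show ?thesis
      using that(2)
    proof (induction u)
      case (Prd u v)
      note c = word_value_closed'[OF \<phi>, of u] word_value_closed'[OF \<phi>, of v] i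
      show ?case
      proof (cases "i \<in> letters v")
        case True
        then show ?thesis
          using Prd c by (simp add: assoc)
      next
        case False
        then have "word_value S \<phi> u \<cdot>\<^bsub>S\<^esub> \<phi> i = word_value S \<phi> u"
          using Prd by auto
        then show ?thesis
          using c comm[of "word_value S \<phi> v" "\<phi> i"] by (simp add: assoc) (simp flip: assoc)
      qed
    qed (use i in \<open>auto simp: idem bar_idempotent word_value_closed'[OF \<phi>]\<close>)
  qed
  have "satisfies S (u, v)" if "letters u = letters v" for u v
    unfolding satisfies_def fst_conv snd_conv
  proof (intro allI impI)
    fix \<phi> :: "nat \<Rightarrow> 'a" assume \<phi>: "range \<phi> \<subseteq> carrier S"
    note c = word_value_closed'[OF \<phi>]
    have "word_value S \<phi> u \<cdot>\<^bsub>S\<^esub> word_value S \<phi> v = word_value S \<phi> u"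
      using that by (intro absorb below \<phi> c) auto
    moreover have "word_value S \<phi> v \<cdot>\<^bsub>S\<^esub> word_value S \<phi> u = word_value S \<phi> v"
      using that by (intro absorb below \<phi> c) auto
    ultimately show "word_value S \<phi> u = word_value S \<phi> v"
      using comm c by metis
  qed
  then show "S \<in> models content_theory"
    by (auto simp: models_def content_theory_def closed_alg)
next
  fix S :: "'a unary_alg" assume S: "S \<in> models content_theory"
  have "x \<cdot>\<^bsub>S\<^esub> x = x" if "x \<in> carrier S" for x
    using satisfiesD[OF models_satisfy[OF S], of "Prd (Letter 0) (Letter 0)" "Letter 0" "\<lambda>_. x"] that
    by (auto simp: content_theory_def)
  moreover have "x \<cdot>\<^bsub>S\<^esub> y = y \<cdot>\<^bsub>S\<^esub> x" if "x \<in> carrier S" "y \<in> carrier S" for x y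
    using satisfiesD[OF models_satisfy[OF S], of "Prd (Letter 0) (Letter 1)" "Prd (Letter 1) (Letter 0)"
        "\<lambda>i. if i = 0 then x else y"] that
    by (auto simp: content_theory_def)
  moreover have "epigroup_alg S"
    using models_epi_theory_drazin[OF epi_theory_content_theory S] by (simp add: epigroup_alg_iff_drazin)
  ultimately show "S \<in> semilattice_variety"
    by (simp add: semilattice_variety_def)
qed

definition womega :: "uword \<Rightarrow> uword" where
  "womega u = Prd u (Bar u)"

lemma letters_womega [simp]: "letters (womega u) = letters u"
  by (simp add: womega_def)

lemma (in drazin_algebra) word_value_womega: "word_value S \<phi> (womega u) = omega (word_value S \<phi> u)"
  by (simp add: womega_def omega_def)

text \<open>Pseudoinversion stays inside principal ideals because \<open>bar S x\<close> is a multiple of \<open>x\<close>.  The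
  cube provides a factor on either side of \<open>b\<close>.\<close>

lemma (in drazin_algebra) letter_divides_value:
  assumes \<phi>: "range \<phi> \<subseteq> carrier S" and b: "b \<in> carrier S" "\<phi> i = (b \<cdot> b) \<cdot> b" and "i \<in> letters u"
  shows "\<exists>c\<in>carrier S. \<exists>d\<in>carrier S. word_value S \<phi> u = (c \<cdot> b) \<cdot> d"
  using assms(4)
proof (induction u)
  case (Prd u v)
  note c = word_value_closed'[OF \<phi>, of u] word_value_closed'[OF \<phi>, of v]
  show ?case
  proof (cases "i \<in> letters u")
    case True
    then obtain p q where pq: "p \<in> carrier S" "q \<in> carrier S" "word_value S \<phi> u = (p \<cdot> b) \<cdot> q"
      using Prd by blast
    then have "word_value S \<phi> (Prd u v) = (p \<cdot> b) \<cdot> (q \<cdot> word_value S \<phi> v)"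
      using c b by (simp add: assoc prd_closed)
    then show ?thesis
      using pq c prd_closed by blast
  next
    case False
    then obtain p q where pq: "p \<in> carrier S" "q \<in> carrier S" "word_value S \<phi> v = (p \<cdot> b) \<cdot> q"
      using Prd by auto
    then have "word_value S \<phi> (Prd u v) = ((word_value S \<phi> u \<cdot> p) \<cdot> b) \<cdot> q"
      using c b by (simp add: assoc prd_closed)
    then show ?thesis
      using pq c prd_closed by blast
  qed
next
  case (Bar u)
  then obtain p q where pq: "p \<in> carrier S" "q \<in> carrier S" "word_value S \<phi> u = (p \<cdot> b) \<cdot> q"
    by auto
  let ?x = "word_value S \<phi> u"
  have x: "?x \<in> carrier S" "bar S ?x \<in> carrier S"
    using word_value_closed'[OF \<phi>] bar_closed by blast+
  have "bar S ?x = (bar S ?x \<cdot> ?x) \<cdot> bar S ?x"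
    using bar_reflexive x by simp
  also have "\<dots> = ((bar S ?x \<cdot> p) \<cdot> b) \<cdot> (q \<cdot> bar S ?x)"
    using pq b x by (metis assoc prd_closed)
  finally show ?case
    using pq x prd_closed by auto
qed (use b in auto)

text \<open>Here \<open>a\<close> lies in the minimal ideal.  Taking for \<open>b\<close> a high power of \<open>sa\<close> gives
  \<open>a = c(s'a)d = (cs')a d\<close>, and iterating this shows that the idempotent \<open>(cs')\<^sup>\<omega>\<close> fixes \<open>a\<close> from
  the left.  Hence \<open>a\<close> is a left multiple of that power, which absorbs \<open>(sa)\<^sup>\<omega>\<close> from the right.\<close>

lemma (in drazin_algebra) minimal_ideal_absorbs_omega:
  assumes a: "a \<in> carrier S" and s: "s \<in> carrier S"
    and min: "\<And>b. b \<in> carrier S \<Longrightarrow> \<exists>c\<in>carrier S. \<exists>d\<in>carrier S. a = (c \<cdot> b) \<cdot> d"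
  shows "a \<cdot> omega (s \<cdot> a) = a"
proof -
  let ?t = "s \<cdot> a"
  have t: "?t \<in> carrier S"
    using a s by (rule prd_closed[rotated])
  obtain n where n: "spow S ?t n \<cdot> omega ?t = spow S ?t n"
    using index[OF t] spow_omega_iff[OF t] by blast
  define s' where "s' = spow S ?t n \<cdot> s"
  have s': "s' \<in> carrier S"
    using s t by (auto simp: s'_def spow_closed prd_closed)
  have b: "spow S ?t (Suc n) = s' \<cdot> a"
    using a s t by (simp add: s'_def assoc spow_closed)
  obtain c d where cd: "c \<in> carrier S" "d \<in> carrier S" "a = (c \<cdot> (s' \<cdot> a)) \<cdot> d"
    using min[of "s' \<cdot> a"] a s' prd_closed by blast
  define g where "g = c \<cdot> s'"
  have g: "g \<in> carrier S"
    using cd s' by (simp add: g_def prd_closed)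
  have step: "a = (g \<cdot> a) \<cdot> d"
    using cd a s' by (simp add: g_def assoc prd_closed)
  have iter: "a = (spow S g k \<cdot> a) \<cdot> spow S d k" for k
  proof (induction k)
    case (Suc k)
    have "a = (spow S g k \<cdot> ((g \<cdot> a) \<cdot> d)) \<cdot> spow S d k"
      using Suc step by simp
    also have "\<dots> = ((spow S g k \<cdot> g) \<cdot> a) \<cdot> (d \<cdot> spow S d k)"
      using g a cd by (simp add: assoc prd_closed spow_closed)
    also have "d \<cdot> spow S d k = spow S d k \<cdot> d"
      using spow_commutes[of d d k] cd by simp
    finally show ?case
      by simp
  qed (use step in simp)
  obtain k where k: "spow S g k \<cdot> omega g = spow S g k"
    using index[OF g] spow_omega_iff[OF g] by blast
  then have "omega g \<cdot> spow S g k = spow S g k"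
    using spow_commutes[of g "omega g" k] g omega_closed omega_commute by simp
  then have "omega g \<cdot> a = a"
    using iter[of k] g a cd omega_closed[OF g] by (metis assoc prd_closed spow_closed)
  then have "a = (bar S g \<cdot> c) \<cdot> (s' \<cdot> a)"
    using g a cd s' bar_closed[OF g] bar_commute[OF g]
    by (simp add: omega_def) (simp add: g_def assoc prd_closed)
  moreover have "(s' \<cdot> a) \<cdot> omega ?t = s' \<cdot> a"
    using index_mono[OF t n, of "Suc n"] b by simp
  ultimately show ?thesis
    using g a cd s' bar_closed[OF g] omega_closed[OF t] by (metis assoc prd_closed)
qed

text \<open>If two words of different content are identified, a letter of one of them can be varied
  freely without changing the common value, which therefore lies in every ideal.\<close>

lemma heterotypical_absorbs_omega:
  assumes Z: "epi_theory Z" and uv: "(u, v) \<in> Z" and "letters u \<noteq> letters v"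
  shows "(u, Prd u (womega (Prd s u))) \<in> Z"
proof (rule in_theory_if_models_satisfy[OF epi_theory_fully_invariant[OF Z]])
  fix S :: "nat unary_alg" and \<phi> :: "nat \<Rightarrow> nat"
  assume S: "S \<in> models Z" and \<phi>: "range \<phi> \<subseteq> carrier S"
  interpret drazin_algebra S
    by (rule models_epi_theory_drazin[OF Z S])
  obtain p q i where pq: "(p, q) = (u, v) \<or> (p, q) = (v, u)" "i \<in> letters p" "i \<notin> letters q"
    using assms(3) by blast
  let ?a = "word_value S \<phi> u"
  have "\<exists>c\<in>carrier S. \<exists>d\<in>carrier S. ?a = (c \<cdot>\<^bsub>S\<^esub> b) \<cdot>\<^bsub>S\<^esub> d" if b: "b \<in> carrier S" for b
  proof -
    let ?\<psi> = "\<phi>(i := (b \<cdot>\<^bsub>S\<^esub> b) \<cdot>\<^bsub>S\<^esub> b)"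
    have \<psi>: "range ?\<psi> \<subseteq> carrier S"
      using \<phi> b prd_closed by auto
    have "?a = word_value S \<phi> q"
      using pq satisfiesD[OF models_satisfy[OF S uv] \<phi>] by auto
    also have "\<dots> = word_value S ?\<psi> q"
      using pq by (intro word_value_cong) auto
    also have "\<dots> = word_value S ?\<psi> p"
      using pq satisfiesD[OF models_satisfy[OF S uv] \<psi>] by auto
    finally show ?thesis
      using letter_divides_value[OF \<psi> b _ pq(2)] by auto
  qed
  then show "?a = word_value S \<phi> (Prd u (womega (Prd s u)))"
    using minimal_ideal_absorbs_omega word_value_closed'[OF \<phi>] by (simp add: word_value_womega)
qed

lemma subst_ident: "(\<And>i. i \<in> letters u \<Longrightarrow> \<sigma> i = Letter i) \<Longrightarrow> subst \<sigma> u = u"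
  by (induction u) auto

text \<open>A chain of steps between two words of equal content \<open>C\<close> may pass through words of other
  content, but only steps in \<open>Z\<close> change the content.  The map \<open>w \<mapsto> w(sw)\<^sup>\<omega>\<close>, applied after
  collapsing the letters outside of \<open>C\<close>, turns the chain into one of words of content \<open>C\<close>.  An end
  of the chain is connected to its image by following the chain up to the first step that changes
  the content: the word before that step is related by \<open>Z\<close> to its image, by
  \<open>heterotypical_absorbs_omega\<close>.\<close>

lemma upper_modular_content_theory: "upper_modular_theory content_theory"
  unfolding upper_modular_theory_def
proof (intro conjI allI impI subsetI)
  show "epi_theory content_theory"
    by (rule epi_theory_content_theory)
  fix Y Z p assume Y: "epi_theory Y" "Y \<subseteq> content_theory" and Z: "epi_theory Z"
    and p: "p \<in> (Z \<union> Y)\<^sup>+ \<inter> content_theory"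
  define T where "T = ((Z \<inter> content_theory) \<union> Y)\<^sup>+"
  obtain s v where sv: "p = (s, v)" "(s, v) \<in> (Z \<union> Y)\<^sup>+" "letters v = letters s"
    using p by (auto simp: content_theory_def)
  have T: "fully_invariant T"
    unfolding T_def using Y Z epi_theory_content_theory
    by (intro epi_theory_fully_invariant epi_theory_join epi_theory_Int)
  have J: "fully_invariant ((Z \<union> Y)\<^sup>+)"
    using Y Z by (intro epi_theory_fully_invariant epi_theory_join)
  have T_content: "T \<subseteq> content_theory"
    unfolding T_def using Y by (intro join_least fully_invariant_content_theory) auto
  obtain c where c: "c \<in> letters s"
    using letters_nonempty by blast
  define \<sigma> where "\<sigma> i = (if i \<in> letters s then Letter i else Letter c)" for i
  define h where "h w = Prd (subst \<sigma> w) (womega (Prd s (subst \<sigma> w)))" for w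
  have "letters (subst \<sigma> w) \<subseteq> letters s" for w
    using c by (auto simp: letters_subst \<sigma>_def split: if_splits)
  then have letters_h: "letters (h w) = letters s" for w
    by (auto simp: h_def)
  have h_cong: "(h w, h w') \<in> \<theta>" if "(w, w') \<in> \<theta>" "fully_invariant \<theta>" for \<theta> w w'
    unfolding h_def womega_def using that
    by (intro fully_invariant_Prd fully_invariant_Bar fully_invariant_subst fully_invariant_refl)
  have h_T: "(h w, h w') \<in> T" if "(w, w') \<in> (Z \<union> Y)\<^sup>+" for w w'
    using that
  proof (induction rule: trancl_induct)
    have *: "(h a, h b) \<in> T" if "(a, b) \<in> Z \<union> Y" for a b
      using that h_cong epi_theory_fully_invariant Y(1) Z
      by (auto simp: T_def content_theory_def letters_h intro!: r_into_trancl)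
    {
      case (base w')
      then show ?case by (rule *)
    }
    case (step w' w'')
    then show ?case
      using * fully_invariant_trans[OF T] by blast
  qed
  have key: "(u, w) \<in> T \<or> (u, h u) \<in> T" if "(u, w) \<in> (Z \<union> Y)\<^sup>+" "letters u = letters s" for u w
    using that(1)
  proof (induction rule: trancl_induct)
    have *: "(a, b) \<in> T \<or> (a, h a) \<in> T" if ab: "(a, b) \<in> Z \<union> Y" and a: "letters a = letters s" for a b
    proof (cases "(a, b) \<in> Y \<or> letters a = letters b")
      case True
      then show ?thesis
        using ab by (auto simp: T_def content_theory_def)
    next
      case False
      have "subst \<sigma> a = a"
        using a by (intro subst_ident) (auto simp: \<sigma>_def)
      then have "(a, h a) \<in> Z"
        using heterotypical_absorbs_omega[OF Z, of a b s] False ab by (auto simp: h_def)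
      then show ?thesis
        using letters_h[of a] a by (auto simp: T_def content_theory_def intro!: r_into_trancl)
    qed
    {
      case (base w)
      then show ?case
        using * that(2) by blast
    }
    case (step w w')
    show ?case
    proof (cases "(u, h u) \<in> T")
      case False
      then have uw: "(u, w) \<in> T"
        using step by blast
      then have "letters w = letters s"
        using T_content that(2) by (auto simp: content_theory_def)
      then have "(w, w') \<in> T \<or> (w, h w) \<in> T"
        using * step by blast
      moreover have "(h w, h u) \<in> T"
        using h_T[OF fully_invariant_sym[OF J]] step by blast
      ultimately show ?thesis
        using uw fully_invariant_trans[OF T] by blast
    qed simp
  qed
  have "(s, v) \<in> T \<or> (s, h s) \<in> T" "(v, s) \<in> T \<or> (v, h v) \<in> T"
    using key[OF sv(2)] key[OF fully_invariant_sym[OF J sv(2)]] sv(3) by auto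
  then have "(s, v) \<in> T"
    using h_T[OF sv(2)] T by (meson fully_invariant_sym fully_invariant_trans)
  then show "p \<in> ((Z \<inter> content_theory) \<union> Y)\<^sup>+"
    by (simp add: sv T_def)
qed

section \<open>Semigroup words and nil theories\<close>

text \<open>Terms with the same word as their value are equal by associativity.  The value \<open>None\<close> marks the
  terms with pseudoinversion, which vanish in all nil semigroups.\<close>

primrec flat :: "uword \<Rightarrow> nat list option" where
  "flat (Letter i) = Some [i]"
| "flat (Prd u v) = (case flat u of None \<Rightarrow> None | Some a \<Rightarrow> map_option (append a) (flat v))"
| "flat (Bar u) = None"

fun term_of :: "nat list \<Rightarrow> uword" where
  "term_of (i # j # w) = Prd (Letter i) (term_of (j # w))"
| "term_of w = Letter (hd w)"

lemma flat_Prd_Some: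
  "flat (Prd u v) = Some w \<longleftrightarrow> (\<exists>a b. flat u = Some a \<and> flat v = Some b \<and> w = a @ b)"
  by (auto split: option.splits)

lemma flat_Prd_None: "flat (Prd u v) = None \<longleftrightarrow> flat u = None \<or> flat v = None"
  by (auto split: option.splits)

lemma flat_nonempty: "flat u = Some w \<Longrightarrow> w \<noteq> []"
  by (induction u arbitrary: w) (auto simp: flat_Prd_Some simp del: flat.simps(2))

lemma letters_flat: "flat u = Some w \<Longrightarrow> letters u = set w"
  by (induction u arbitrary: w) (auto simp: flat_Prd_Some simp del: flat.simps(2))

lemma flat_term_of: "w \<noteq> [] \<Longrightarrow> flat (term_of w) = Some w"
  by (induction w rule: term_of.induct) auto

lemma flat_subst_None: "flat u = None \<Longrightarrow> flat (subst \<sigma> u) = None"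
  by (induction u) (auto simp: flat_Prd_None simp del: flat.simps(2))

lemma flat_subst_None':
  "flat u = Some w \<Longrightarrow> i \<in> set w \<Longrightarrow> flat (\<sigma> i) = None \<Longrightarrow> flat (subst \<sigma> u) = None"
  by (induction u arbitrary: w) (auto simp: flat_Prd_Some flat_Prd_None simp del: flat.simps(2))

lemma flat_subst_Some:
  "flat u = Some w \<Longrightarrow> (\<And>i. i \<in> set w \<Longrightarrow> flat (\<sigma> i) = Some (\<tau> i)) \<Longrightarrow>
     flat (subst \<sigma> u) = Some (concat (map \<tau> w))"
  by (induction u arbitrary: w) (auto simp: flat_Prd_Some simp del: flat.simps(2))

lemma flat_wpow: "flat (wpow (Letter i) n) = Some (replicate (Suc n) i)"
proof (induction n)
  case (Suc n)
  then show ?case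
    by (simp add: replicate_append_same)
qed simp

lemma epi_theory_assoc:
  assumes "epi_theory \<theta>"
  shows "(Prd (Prd u v) w, Prd u (Prd v w)) \<in> \<theta>"
proof (rule in_theory_if_models_satisfy[OF epi_theory_fully_invariant[OF assms]])
  fix S :: "nat unary_alg" and \<phi> :: "nat \<Rightarrow> nat"
  assume S: "S \<in> models \<theta>" and \<phi>: "range \<phi> \<subseteq> carrier S"
  interpret drazin_algebra S
    by (rule models_epi_theory_drazin[OF assms S])
  show "word_value S \<phi> (Prd (Prd u v) w) = word_value S \<phi> (Prd u (Prd v w))"
    using word_value_closed'[OF \<phi>] by (simp add: assoc)
qed

lemma term_of_flat_in_theory:
  assumes \<theta>: "epi_theory \<theta>" and "flat u = Some w"
  shows "(u, term_of w) \<in> \<theta>"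
proof -
  note fi = epi_theory_fully_invariant[OF \<theta>]
  have append: "(Prd (term_of a) (term_of b), term_of (a @ b)) \<in> \<theta>" if "a \<noteq> []" "b \<noteq> []" for a b
    using that(1)
  proof (induction a rule: term_of.induct)
    case (1 i j w)
    then have "(Prd (Letter i) (Prd (term_of (j # w)) (term_of b)), term_of ((i # j # w) @ b)) \<in> \<theta>"
      using fully_invariant_Prd[OF fi fully_invariant_refl[OF fi]] by simp
    then show ?case
      using fully_invariant_trans[OF fi epi_theory_assoc[OF \<theta>]] by simp
  next
    case ("2_2" i)
    then show ?case
      using that(2) fully_invariant_refl[OF fi] by (cases b) auto
  qed auto
  show ?thesis
    using assms(2)
  proof (induction u arbitrary: w)
    case (Letter i)
    then show ?case
      using fully_invariant_refl[OF fi] by auto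
  next
    case (Prd u v)
    then obtain a b where ab: "flat u = Some a" "flat v = Some b" "w = a @ b"
      by (auto simp: flat_Prd_Some simp del: flat.simps(2))
    then have "(Prd u v, Prd (term_of a) (term_of b)) \<in> \<theta>"
      using Prd.IH fully_invariant_Prd[OF fi] by blast
    then show ?case
      using append[OF flat_nonempty flat_nonempty] ab fully_invariant_trans[OF fi] by blast
  qed auto
qed

lemma same_flat_in_theory:
  assumes "epi_theory \<theta>" "flat u = Some w" "flat v = Some w"
  shows "(u, v) \<in> \<theta>"
  using term_of_flat_in_theory[OF assms(1)] assms epi_theory_fully_invariant[OF assms(1)]
  by (meson fully_invariant_sym fully_invariant_trans)

text \<open>The words in \<open>J\<close> are to vanish, and those related by \<open>R\<close> are to be identified.  The empty set
  stands for zero, which makes \<open>nil_theory\<close> below the kernel of a map.\<close>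

definition word_class :: "nat list set \<Rightarrow> (nat list \<times> nat list) set \<Rightarrow> nat list \<Rightarrow> nat list set" where
  "word_class J R w = (if w \<in> J then {} else R\<^sup>* `` {w})"

definition term_class :: "nat list set \<Rightarrow> (nat list \<times> nat list) set \<Rightarrow> uword \<Rightarrow> nat list set" where
  "term_class J R u = (case flat u of None \<Rightarrow> {} | Some w \<Rightarrow> word_class J R w)"

definition nil_theory :: "nat list set \<Rightarrow> (nat list \<times> nat list) set \<Rightarrow> (uword \<times> uword) set" where
  "nil_theory J R = {(u, v). term_class J R u = term_class J R v}"

definition word_ideal :: "nat list set \<Rightarrow> bool" where
  "word_ideal J \<longleftrightarrow>
     (\<forall>w\<in>J. \<forall>a. a @ w \<in> J \<and> w @ a \<in> J) \<and>
     (\<forall>w\<in>J. \<forall>\<tau>. (\<forall>i. \<tau> i \<noteq> []) \<longrightarrow> concat (map \<tau> w) \<in> J)"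

text \<open>Proper multiples of the words to be identified are required to vanish, so that \<open>R\<close> need not be
  compatible with multiplication.\<close>

definition top_rewriting :: "nat list set \<Rightarrow> (nat list \<times> nat list) set \<Rightarrow> bool" where
  "top_rewriting J R \<longleftrightarrow> sym R \<and>
     (\<forall>(a, b)\<in>R. a \<notin> J \<and> set a = set b \<and> (\<forall>c. c \<noteq> [] \<longrightarrow> a @ c \<in> J \<and> c @ a \<in> J) \<and>
        (\<forall>\<tau>. (\<forall>i. \<tau> i \<noteq> []) \<longrightarrow>
           (concat (map \<tau> a), concat (map \<tau> b)) \<in> R \<or>
           (concat (map \<tau> a) \<in> J \<and> concat (map \<tau> b) \<in> J)))"

lemma top_rewriting_empty: "top_rewriting J {}"
  by (simp add: top_rewriting_def sym_def)

lemma top_rewriting_vanish: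
  "top_rewriting J R \<Longrightarrow> (a, b) \<in> R \<Longrightarrow> c \<noteq> [] \<Longrightarrow> a @ c \<in> J \<and> c @ a \<in> J"
  by (auto simp: top_rewriting_def)

lemma top_rewriting_subst:
  assumes "top_rewriting J R" "(a, b) \<in> R" "\<And>i. \<tau> i \<noteq> []"
  shows "(concat (map \<tau> a), concat (map \<tau> b)) \<in> R \<or>
    (concat (map \<tau> a) \<in> J \<and> concat (map \<tau> b) \<in> J)"
  using bspec[OF conjunct2[OF assms(1)[unfolded top_rewriting_def]] assms(2)] assms(3) by simp

lemma word_class_eq_iff:
  assumes "sym R"
  shows "word_class J R a = word_class J R b \<longleftrightarrow> a \<in> J \<and> b \<in> J \<or> a \<notin> J \<and> b \<notin> J \<and> (a, b) \<in> R\<^sup>*"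
proof -
  have "R\<^sup>* `` {a} = R\<^sup>* `` {b} \<longleftrightarrow> (a, b) \<in> R\<^sup>*"
    using sym_rtrancl[OF assms] by (auto intro: rtrancl_trans dest: symD)
  then show ?thesis
    by (auto simp: word_class_def)
qed

lemma word_class_empty_iff: "word_class J R w = {} \<longleftrightarrow> w \<in> J"
  by (auto simp: word_class_def)

lemma nil_theory_class:
  assumes "(u, v) \<in> nil_theory J R" "flat u = Some a" "a \<notin> J" "sym R"
  obtains b where "flat v = Some b" "b \<notin> J" "(a, b) \<in> R\<^sup>*"
  using assms word_class_eq_iff[of R J a] word_class_empty_iff[of J R a]
  by (auto simp: nil_theory_def term_class_def split: option.splits)

lemma word_class_step:
  assumes "\<And>a b. (a, b) \<in> R \<Longrightarrow> word_class J R (f a) = word_class J R (f b)" "(a, b) \<in> R\<^sup>*"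
  shows "word_class J R (f a) = word_class J R (f b)"
  using assms(2) by (induction rule: rtrancl_induct) (auto simp: assms(1))

lemma fully_invariant_nil_theory:
  assumes J: "word_ideal J" and R: "top_rewriting J R"
  shows "fully_invariant (nil_theory J R)"
proof (rule fully_invariantI)
  have sym: "sym R"
    using R by (simp add: top_rewriting_def)
  have map_class: "word_class J R (f a) = word_class J R (f b)"
    if "word_class J R a = word_class J R b" "\<And>w. w \<in> J \<Longrightarrow> f w \<in> J"
      "\<And>a b. (a, b) \<in> R \<Longrightarrow> word_class J R (f a) = word_class J R (f b)" for f a b
    using that word_class_step[of R J f a b] by (auto simp: word_class_eq_iff[OF sym])
  have map_term_class: "(case flat u of None \<Rightarrow> {} | Some a \<Rightarrow> word_class J R (f a)) =
      (case flat u' of None \<Rightarrow> {} | Some a \<Rightarrow> word_class J R (f a))"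
    if "(u, u') \<in> nil_theory J R" "\<And>w. w \<in> J \<Longrightarrow> f w \<in> J"
      "\<And>a b. (a, b) \<in> R \<Longrightarrow> word_class J R (f a) = word_class J R (f b)" for f u u'
  proof -
    have eq: "term_class J R u = term_class J R u'"
      using that(1) by (simp add: nil_theory_def)
    have zero: "word_class J R (f a) = {}" if "word_class J R a = {}" for a
      using that \<open>\<And>w. w \<in> J \<Longrightarrow> f w \<in> J\<close> by (simp add: word_class_empty_iff)
    show ?thesis
    proof (cases "flat u")
      case None
      then show ?thesis
        using eq zero by (cases "flat u'") (auto simp: term_class_def)
    next
      case (Some a)
      note u = this
      show ?thesis
      proof (cases "flat u'")
        case None
        then show ?thesis
          using eq u zero by (simp add: term_class_def)
      next
        case (Some b)
        then have "word_class J R a = word_class J R b"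
          using eq u by (simp add: term_class_def)
        then have "word_class J R (f a) = word_class J R (f b)"
          using that(2,3) by (rule map_class)
        then show ?thesis
          using u Some by simp
      qed
    qed
  qed
  {
    fix u u' v assume uu: "(u, u') \<in> nil_theory J R"
    have "(Prd u v, Prd u' v) \<in> nil_theory J R \<and> (Prd v u, Prd v u') \<in> nil_theory J R"
    proof (cases "flat v")
      case None
      then show ?thesis
        by (auto simp: nil_theory_def term_class_def split: option.splits)
    next
      case (Some c)
      have "(a @ c \<in> J \<and> c @ a \<in> J) \<and> (b @ c \<in> J \<and> c @ b \<in> J)" if "(a, b) \<in> R" for a b
        using top_rewriting_vanish[OF R that] top_rewriting_vanish[OF R symD[OF sym that]]
          flat_nonempty[OF Some] by blast
      then have "(case flat u of None \<Rightarrow> {} | Some a \<Rightarrow> word_class J R (f a)) =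
          (case flat u' of None \<Rightarrow> {} | Some a \<Rightarrow> word_class J R (f a))"
        if "f = (\<lambda>a. a @ c) \<or> f = (\<lambda>a. c @ a)" for f
        using that J by (intro map_term_class uu) (auto simp: word_ideal_def word_class_def)
      from this[of "\<lambda>a. a @ c"] this[of "\<lambda>a. c @ a"] show ?thesis
        using Some by (auto simp: nil_theory_def term_class_def split: option.splits)
    qed
  }
  then show "(Prd u v, Prd u' v) \<in> nil_theory J R" "(Prd v u, Prd v u') \<in> nil_theory J R"
    if "(u, u') \<in> nil_theory J R" for u u' v
    using that by blast+
  show "(subst \<sigma> u, subst \<sigma> u') \<in> nil_theory J R" if uu: "(u, u') \<in> nil_theory J R" for \<sigma> u u'
  proof -
    \<comment> \<open>The default \<open>[0]\<close> keeps all values nonempty, as \<open>word_ideal\<close> demands.\<close>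
    define \<tau> where "\<tau> i = (case flat (\<sigma> i) of None \<Rightarrow> [0] | Some w \<Rightarrow> w)" for i
    have \<tau>: "\<tau> i \<noteq> []" for i
      using flat_nonempty by (auto simp: \<tau>_def split: option.splits)
    have sub: "flat (subst \<sigma> w) = (if \<exists>i\<in>set a. flat (\<sigma> i) = None then None else Some (concat (map \<tau> a)))"
      if "flat w = Some a" for w a
      using that flat_subst_None'[OF that] flat_subst_Some[OF that, of \<sigma> \<tau>]
      by (auto simp: \<tau>_def split: option.splits)
    have zero: "term_class J R (subst \<sigma> w) = {}" if "term_class J R w = {}" for w
    proof (cases "flat w")
      case (Some a)
      then have "concat (map \<tau> a) \<in> J"
        using that J \<tau> by (auto simp: term_class_def word_class_empty_iff word_ideal_def)
      then show ?thesis
        using sub[OF Some] by (simp add: term_class_def word_class_def)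
    qed (simp add: term_class_def flat_subst_None)
    show ?thesis
    proof (cases "term_class J R u = {}")
      case True
      then show ?thesis
        using that zero by (auto simp: nil_theory_def)
    next
      case False
      then obtain a b where ab: "flat u = Some a" "flat u' = Some b"
        using uu False by (auto simp: nil_theory_def term_class_def split: option.splits)
      then have eq: "word_class J R a = word_class J R b"
        using that by (simp add: nil_theory_def term_class_def)
      have "a \<notin> J"
        using False ab by (simp add: term_class_def word_class_empty_iff)
      then have "(a, b) \<in> R\<^sup>*"
        using eq by (simp add: word_class_eq_iff[OF sym])
      then have "set a = set b"
        using R by (induction rule: rtrancl_induct) (auto simp: top_rewriting_def)
      moreover have "word_class J R (concat (map \<tau> a)) = word_class J R (concat (map \<tau> b))"
      proof (rule map_class[OF eq])
        show "concat (map \<tau> w) \<in> J" if "w \<in> J" for w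
          using J that \<tau> by (simp add: word_ideal_def)
        show "word_class J R (concat (map \<tau> w)) = word_class J R (concat (map \<tau> w'))"
          if "(w, w') \<in> R" for w w'
        proof -
          have "(concat (map \<tau> w), concat (map \<tau> w')) \<in> R \<or>
              (concat (map \<tau> w) \<in> J \<and> concat (map \<tau> w') \<in> J)"
            using top_rewriting_subst[OF R that] \<tau> by blast
          then show ?thesis
          proof
            assume *: "(concat (map \<tau> w), concat (map \<tau> w')) \<in> R"
            then have "concat (map \<tau> w) \<notin> J" "concat (map \<tau> w') \<notin> J"
              using R symD[OF sym *] unfolding top_rewriting_def by blast+
            with * show ?thesis
              by (simp add: word_class_eq_iff[OF sym])
          qed (simp add: word_class_def)
        qed
      qed
      ultimately show ?thesis
        using ab sub[OF ab(1)] sub[OF ab(2)] by (auto simp: nil_theory_def term_class_def)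
    qed
  qed
qed (auto simp: nil_theory_def term_class_def)

lemma epi_theory_nil_theory:
  assumes "word_ideal J" "top_rewriting J R" "replicate (Suc m) 0 \<in> J"
  shows "epi_theory (nil_theory J R)"
  unfolding epi_theory_def
proof (intro conjI exI[of _ m])
  show "drazin_ids m \<subseteq> nil_theory J R"
    using assms(3)
    by (auto simp: drazin_ids_def Let_def nil_theory_def term_class_def flat_wpow word_class_def
         split: option.splits)
qed (rule fully_invariant_nil_theory[OF assms(1,2)])

lemma length_concat_nonempty:
  "(\<And>i. \<tau> i \<noteq> []) \<Longrightarrow> length w \<le> length (concat (map \<tau> w))"
proof (induction w)
  case (Cons i w)
  then have "0 < length (\<tau> i)"
    by simp
  then show ?case
    using Cons by (simp del: length_greater_0_conv)
qed simp

lemma word_ideal_long: "word_ideal {w. l < length w}"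
  using length_concat_nonempty by (force simp: word_ideal_def intro: less_le_trans)


section \<open>The theory of a zero-reduced variety\<close>

definition zero_words :: "(uword \<times> uword) set \<Rightarrow> uword set" where
  "zero_words \<theta> = {w. \<forall>v. (Prd w v, w) \<in> \<theta> \<and> (Prd v w, w) \<in> \<theta>}"

lemma subst_update: "i \<notin> letters w \<Longrightarrow> subst (\<sigma>(i := v)) w = subst \<sigma> w"
  by (induction w) auto

context
  fixes \<theta> assumes fi: "fully_invariant \<theta>"
begin

lemma zero_words_subst:
  assumes "zero_identities w \<subseteq> \<theta>"
  shows "subst \<sigma> w \<in> zero_words \<theta>"
proof -
  obtain i where i: "i \<notin> letters w"
    using ex_new_if_finite[OF infinite_UNIV_nat finite_letters] by blast
  then have "(Prd w (Letter i), w) \<in> \<theta>" "(Prd (Letter i) w, w) \<in> \<theta>"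
    using assms by (auto simp: zero_identities_def)
  then have "(subst (\<sigma>(i := v)) (Prd w (Letter i)), subst (\<sigma>(i := v)) w) \<in> \<theta>"
      "(subst (\<sigma>(i := v)) (Prd (Letter i) w), subst (\<sigma>(i := v)) w) \<in> \<theta>" for v
    using fully_invariant_subst[OF fi] by blast+
  then show ?thesis
    by (simp add: zero_words_def subst_update[OF i])
qed

lemma zero_identities_iff: "zero_identities w \<subseteq> \<theta> \<longleftrightarrow> w \<in> zero_words \<theta>"
proof
  show "w \<in> zero_words \<theta>" if "zero_identities w \<subseteq> \<theta>"
    using zero_words_subst[OF that, of Letter] by (simp add: subst_ident)
qed (auto simp: zero_words_def zero_identities_def)

lemma subst_in_zero_words: "w \<in> zero_words \<theta> \<Longrightarrow> subst \<sigma> w \<in> zero_words \<theta>"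
  by (simp add: zero_words_subst zero_identities_iff)

lemma zero_words_related: "u \<in> zero_words \<theta> \<Longrightarrow> v \<in> zero_words \<theta> \<Longrightarrow> (u, v) \<in> \<theta>"
  unfolding zero_words_def by (blast intro: fully_invariant_sym[OF fi] fully_invariant_trans[OF fi])

lemma zero_words_closed:
  assumes "u \<in> zero_words \<theta>" "(u, v) \<in> \<theta>"
  shows "v \<in> zero_words \<theta>"
proof -
  have "(Prd u w, u) \<in> \<theta>" "(Prd w u, u) \<in> \<theta>" for w
    using assms(1) by (auto simp: zero_words_def)
  moreover have "(Prd v w, Prd u w) \<in> \<theta>" "(Prd w v, Prd w u) \<in> \<theta>" for w
    using fully_invariant_sym[OF fi assms(2)] fully_invariant_refl[OF fi]
    by (auto intro: fully_invariant_Prd[OF fi])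
  ultimately have "(Prd v w, v) \<in> \<theta>" "(Prd w v, v) \<in> \<theta>" for w
    using assms(2) by (meson fully_invariant_trans[OF fi])+
  then show ?thesis
    by (simp add: zero_words_def)
qed

lemma zero_words_Prd:
  assumes "u \<in> zero_words \<theta>"
  shows "Prd u v \<in> zero_words \<theta>" "Prd v u \<in> zero_words \<theta>"
  using assms zero_words_closed[OF assms fully_invariant_sym[OF fi]] by (auto simp: zero_words_def)

end

context
  fixes \<theta> assumes \<theta>: "epi_theory \<theta>"
begin

lemmas theory_invariant = epi_theory_fully_invariant[OF \<theta>]

text \<open>If all letters of \<open>w\<close> take the idempotent value \<open>u\<^sup>\<omega>\<close>, then so does \<open>w\<close>.  Hence \<open>u\<^sup>\<omega>\<close> is
  zero, and the pseudoinverse of \<open>u\<close> is a multiple of it.\<close>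

lemma Bar_zero_word:
  assumes "w \<in> zero_words \<theta>"
  shows "Bar u \<in> zero_words \<theta>"
proof -
  let ?e = "womega u"
  have "(subst (\<lambda>_. ?e) w, ?e) \<in> \<theta> \<and> (Prd (Bar u) ?e, Bar u) \<in> \<theta>"
  proof (intro conjI; rule in_theory_if_models_satisfy[OF theory_invariant])
    fix S :: "nat unary_alg" and \<phi> :: "nat \<Rightarrow> nat"
    assume S: "S \<in> models \<theta>" and \<phi>: "range \<phi> \<subseteq> carrier S"
    interpret drazin_algebra S
      by (rule models_epi_theory_drazin[OF \<theta> S])
    show "word_value S \<phi> (subst (\<lambda>_. ?e) w) = word_value S \<phi> ?e"
      using word_value_closed'[OF \<phi>] by (simp add: word_value_subst word_value_womega
          word_value_idempotent omega_idempotent omega_closed)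
    show "word_value S \<phi> (Prd (Bar u) ?e) = word_value S \<phi> (Bar u)"
      using word_value_closed'[OF \<phi>] by (simp add: word_value_womega bar_omega)
  qed
  then show ?thesis
    using subst_in_zero_words[OF theory_invariant assms] zero_words_closed[OF theory_invariant] zero_words_Prd(2)[OF theory_invariant] by blast
qed

lemma flat_None_zero_word:
  assumes "w \<in> zero_words \<theta>" "flat u = None"
  shows "u \<in> zero_words \<theta>"
  using assms(2)
  by (induction u) (auto simp: flat_Prd_None zero_words_Prd[OF theory_invariant] Bar_zero_word[OF assms(1)] simp del: flat.simps(2))

lemma word_ideal_zero_words: "word_ideal {w. \<exists>u\<in>zero_words \<theta>. flat u = Some w}"
  unfolding word_ideal_def
proof (intro conjI ballI allI impI)
  fix w a assume "w \<in> {w. \<exists>u\<in>zero_words \<theta>. flat u = Some w}"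
  then obtain u where u: "u \<in> zero_words \<theta>" "flat u = Some w"
    by blast
  show "a @ w \<in> {w. \<exists>u\<in>zero_words \<theta>. flat u = Some w}"
      "w @ a \<in> {w. \<exists>u\<in>zero_words \<theta>. flat u = Some w}"
  proof -
    have "flat (Prd (term_of a) u) = Some (a @ w)" "flat (Prd u (term_of a)) = Some (w @ a)"
      if "a \<noteq> []"
      using u flat_term_of[OF that] by auto
    then show "a @ w \<in> {w. \<exists>u\<in>zero_words \<theta>. flat u = Some w}"
        "w @ a \<in> {w. \<exists>u\<in>zero_words \<theta>. flat u = Some w}"
      using u zero_words_Prd[OF theory_invariant u(1)] unfolding mem_Collect_eq by (metis append_Nil append_Nil2)+
  qed
next
  fix w and \<tau> :: "nat \<Rightarrow> nat list"
  assume "w \<in> {w. \<exists>u\<in>zero_words \<theta>. flat u = Some w}" and \<tau>: "\<forall>i. \<tau> i \<noteq> []"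
  then obtain u where u: "u \<in> zero_words \<theta>" "flat u = Some w"
    by blast
  then have "flat (subst (\<lambda>i. term_of (\<tau> i)) u) = Some (concat (map \<tau> w))"
    using \<tau> by (intro flat_subst_Some) (auto simp: flat_term_of)
  then show "concat (map \<tau> w) \<in> {w. \<exists>u\<in>zero_words \<theta>. flat u = Some w}"
    using subst_in_zero_words[OF theory_invariant u(1)] by blast
qed

end

lemma word_ideal_Un: "word_ideal J \<Longrightarrow> word_ideal J' \<Longrightarrow> word_ideal (J \<union> J')"
  by (auto simp: word_ideal_def)

text \<open>The theories of 0-reduced varieties are of this kind.\<close>

definition zero_isolating :: "(uword \<times> uword) set \<Rightarrow> bool" where
  "zero_isolating \<theta> \<longleftrightarrow> epi_theory \<theta> \<and>
     (\<forall>(u, v)\<in>\<theta>. (flat u \<noteq> None \<and> flat u = flat v) \<or> u \<in> zero_words \<theta> \<and> v \<in> zero_words \<theta>)"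

text \<open>A word that is not zero in the variety is separated from all other words by a nil member of
  the variety: the quotient of the free semigroup in which the zero words and all words longer than
  the given one vanish.  That some word is zero at all follows by the same construction, since nilpotent
  semigroups have unbounded index.\<close>

lemma zero_reduced_theory:
  fixes N :: "'a::infinite unary_alg set"
  assumes "zero_reduced_variety N"
  obtains \<theta> where "N = models \<theta>" "zero_isolating \<theta>"
proof -
  obtain \<theta> where \<theta>: "epi_theory \<theta>" "N = models \<theta>"
    using assms epigroup_variety_theory[of N] unfolding zero_reduced_variety_def by blast
  note fi = epi_theory_fully_invariant[OF \<theta>(1)]
  obtain W where W: "N = {S. epigroup_alg S \<and> (\<forall>w\<in>W. \<forall>p\<in>zero_identities w. satisfies S p)}"
    using assms by (auto simp: zero_reduced_variety_def)
  have W_zero: "W \<subseteq> zero_words \<theta>"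
  proof
    fix w assume "w \<in> W"
    then have "zero_identities w \<subseteq> theory_of N"
      unfolding W theory_of_def by blast
    then show "w \<in> zero_words \<theta>"
      using \<theta> by (simp add: theory_of_models fi zero_identities_iff[OF fi])
  qed
  have sub: "\<theta> \<subseteq> nil_theory J {}" if ep: "epi_theory (nil_theory J {})" and ideal: "word_ideal J"
    and W_J: "\<And>w a. w \<in> W \<Longrightarrow> flat w = Some a \<Longrightarrow> a \<in> J" for J
  proof -
    have "models (nil_theory J {}) \<subseteq> N"
    proof
      fix S :: "'a unary_alg" assume S: "S \<in> models (nil_theory J {})"
      have "p \<in> nil_theory J {}" if w: "w \<in> W" "p \<in> zero_identities w" for w p
      proof (cases "flat w")
        case (Some a)
        have aJ: "a \<in> J"
          using W_J w Some by blast
        then have "a @ [i] \<in> J" "[i] @ a \<in> J" for i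
          using ideal unfolding word_ideal_def by blast+
        then show ?thesis
          using w Some aJ by (auto simp: zero_identities_def nil_theory_def term_class_def word_class_def)
      qed (use w in \<open>auto simp: zero_identities_def nil_theory_def term_class_def\<close>)
      then have "\<forall>w\<in>W. \<forall>p\<in>zero_identities w. satisfies S p"
        using S by (auto simp: models_def)
      then show "S \<in> N"
        using models_epi_theory_drazin[OF ep S] unfolding W by (simp add: epigroup_alg_iff_drazin)
    qed
    then show ?thesis
      using \<theta> ep by (simp add: models_subset_iff epi_theory_fully_invariant)
  qed
  have "W \<noteq> {}"
  proof
    assume "W = {}"
    obtain m where m: "drazin_ids m \<subseteq> \<theta>"
      using \<theta>(1) by (auto simp: epi_theory_def)
    let ?J = "{w :: nat list. Suc m < length w}"
    have "epi_theory (nil_theory ?J {})"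
      by (rule epi_theory_nil_theory[where m = "Suc m"]) (auto simp: word_ideal_long top_rewriting_empty)
    then have "drazin_ids m \<subseteq> nil_theory ?J {}"
      using sub[of ?J] m \<open>W = {}\<close> by (auto simp: word_ideal_long)
    then show False
      by (auto simp: drazin_ids_def Let_def nil_theory_def term_class_def flat_wpow word_class_def
           split: option.splits)
  qed
  then obtain w0 where w0: "w0 \<in> zero_words \<theta>"
    using W_zero by blast
  have key: "flat v = Some a" if uv: "(u, v) \<in> \<theta>" and u: "flat u = Some a" "u \<notin> zero_words \<theta>" for u v a
  proof -
    let ?I = "{w. \<exists>u\<in>zero_words \<theta>. flat u = Some w}"
    let ?J = "?I \<union> {w. length a < length w}"
    have J: "word_ideal ?J"
      by (intro word_ideal_Un word_ideal_zero_words \<theta>(1) word_ideal_long)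
    have "epi_theory (nil_theory ?J {})"
      using J by (rule epi_theory_nil_theory[where m = "length a"]) (auto simp: top_rewriting_empty)
    then have "\<theta> \<subseteq> nil_theory ?J {}"
      using J W_zero by (intro sub) auto
    moreover have "a \<notin> ?J"
      using u zero_words_closed[OF fi] same_flat_in_theory[OF \<theta>(1)] by auto
    ultimately obtain b where "flat v = Some b" "(a, b) \<in> {}\<^sup>*"
      using nil_theory_class[of u v ?J "{}" a] uv u by (auto simp: sym_def)
    then show ?thesis
      by simp
  qed
  have "zero_isolating \<theta>"
    unfolding zero_isolating_def
  proof (intro conjI ballI; clarify?)
    fix u v assume uv: "(u, v) \<in> \<theta>" and *: "\<not> (u \<in> zero_words \<theta> \<and> v \<in> zero_words \<theta>)"
    then have u: "u \<notin> zero_words \<theta>"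
      using zero_words_closed[OF fi _ uv] by blast
    then obtain a where "flat u = Some a"
      using flat_None_zero_word[OF \<theta>(1) w0] by blast
    then show "flat u \<noteq> None \<and> flat u = flat v"
      using key[OF uv] u by auto
  qed (rule \<theta>(1))
  then show thesis
    using that \<theta>(2) by blast
qed

text \<open>In a chain of steps in \<open>Z\<close> and in \<open>Y \<subseteq> \<theta>\<close> that starts at a zero word, every nontrivial step in
  \<open>Y\<close> starts and ends at a zero word.  So the stretches between these steps lie in \<open>Z\<close> and connect
  zero words, which are related by \<open>\<theta>\<close>.  The induction keeps track of the latest zero word
  \<open>z\<close>.\<close>

lemma upper_modular_zero_isolating:
  assumes "zero_isolating \<theta>"
  shows "upper_modular_theory \<theta>"
  unfolding upper_modular_theory_def
proof (intro conjI allI impI subsetI)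
  have \<theta>: "epi_theory \<theta>"
    and iso: "\<And>u v. (u, v) \<in> \<theta> \<Longrightarrow> flat u \<noteq> None \<and> flat u = flat v \<or>
                u \<in> zero_words \<theta> \<and> v \<in> zero_words \<theta>"
    using assms by (auto simp: zero_isolating_def)
  then show "epi_theory \<theta>"
    by blast
  fix Y Z p assume Y: "epi_theory Y" "Y \<subseteq> \<theta>" and Z: "epi_theory Z" and p: "p \<in> (Z \<union> Y)\<^sup>+ \<inter> \<theta>"
  note fiZ = epi_theory_fully_invariant[OF Z]
  define T where "T = ((Z \<inter> \<theta>) \<union> Y)\<^sup>+"
  have T: "fully_invariant T" "Z \<inter> \<theta> \<subseteq> T" "Y \<subseteq> T"
    unfolding T_def using \<theta> Y Z
    by (intro epi_theory_fully_invariant epi_theory_join epi_theory_Int) auto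
  have "\<exists>z\<in>zero_words \<theta>. (u, z) \<in> T \<and> (z, w) \<in> Z"
    if "(u, w) \<in> (Z \<union> Y)\<^sup>*" "u \<in> zero_words \<theta>" for u w
    using that(1)
  proof (induction rule: rtrancl_induct)
    case base
    then show ?case
      using that(2) fully_invariant_refl T(1) fiZ by blast
  next
    case (step w w')
    then obtain z where z: "z \<in> zero_words \<theta>" "(u, z) \<in> T" "(z, w) \<in> Z"
      by blast
    show ?case
    proof (cases "(w, w') \<in> Z")
      case True
      then show ?thesis
        using z fully_invariant_trans[OF fiZ] by blast
    next
      case False
      then have Y': "(w, w') \<in> Y"
        using step by blast
      then have w: "w \<in> zero_words \<theta>" "w' \<in> zero_words \<theta>"
        using iso[of w w'] Y(2) False same_flat_in_theory[OF Z, of w _ w'] by (metis option.exhaust subsetD)+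
      then have "(z, w) \<in> T"
        using z zero_words_related[OF epi_theory_fully_invariant[OF \<theta>]] T(2) by blast
      then have "(u, w') \<in> T"
        using z Y' T fully_invariant_trans by blast
      then show ?thesis
        using w fully_invariant_refl[OF fiZ] by blast
    qed
  qed
  note chain = this
  obtain u v where uv: "p = (u, v)" "(u, v) \<in> (Z \<union> Y)\<^sup>*" "(u, v) \<in> \<theta>"
    using p by (cases p) (auto intro: trancl_into_rtrancl)
  have "(u, v) \<in> T"
  proof (cases "u \<in> zero_words \<theta> \<and> v \<in> zero_words \<theta>")
    case True
    then obtain z where z: "z \<in> zero_words \<theta>" "(u, z) \<in> T" "(z, v) \<in> Z"
      using chain uv by blast
    then have "(z, v) \<in> T"
      using zero_words_related[OF epi_theory_fully_invariant[OF \<theta>]] True T(2) by blast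
    then show ?thesis
      using z T(1) fully_invariant_trans by blast
  next
    case False
    then have "(u, v) \<in> Y"
      using iso[OF uv(3)] same_flat_in_theory[OF Y(1), of u _ v] by (metis option.exhaust)
    then show ?thesis
      using T by blast
  qed
  then show "p \<in> ((Z \<inter> \<theta>) \<union> Y)\<^sup>+"
    by (simp add: uv T_def)
qed

lemma upper_modular_UNIV: "upper_modular_theory UNIV"
  by (auto simp: upper_modular_theory_def epi_theory_UNIV)

section \<open>Identities forced by lower-modularity\<close>

lemma concat_map_singletons:
  "(\<And>i. i \<in> set w \<Longrightarrow> length (\<tau> i) = 1) \<Longrightarrow> concat (map \<tau> w) = map (\<lambda>i. hd (\<tau> i)) w"
proof (induction w)
  case (Cons i w)
  have "length (\<tau> i) = 1"
    using Cons.prems by simp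
  then have "\<tau> i = [hd (\<tau> i)]"
    by (cases "\<tau> i") auto
  then show ?case
    using Cons by auto
qed simp

lemma length_concat_map_less:
  assumes "\<And>i. \<tau> i \<noteq> []" "i \<in> set w" "length (\<tau> i) \<noteq> 1"
  shows "length w < length (concat (map \<tau> w))"
  using assms(2)
proof (induction w)
  case (Cons j w)
  have "0 < length (\<tau> i)" "0 < length (\<tau> j)"
    using assms(1) by auto
  moreover have "length w \<le> length (concat (map \<tau> w))"
    by (rule length_concat_nonempty) (rule assms(1))
  ultimately show ?case
    using Cons assms(3) by (cases "i = j") (auto simp del: length_greater_0_conv)
qed simp

lemma word_ideal_instances: "word_ideal ({w. length q < length w} \<union> {map \<sigma> q | \<sigma> :: nat \<Rightarrow> nat. True})"
  (is "word_ideal ?J")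
  unfolding word_ideal_def
proof (intro conjI ballI allI impI)
  fix w a assume "w \<in> ?J"
  then show "a @ w \<in> ?J" "w @ a \<in> ?J"
    by (cases "a = []"; auto)+
next
  fix w and \<tau> :: "nat \<Rightarrow> nat list" assume w: "w \<in> ?J" and \<tau>: "\<forall>i. \<tau> i \<noteq> []"
  then have len: "length q \<le> length w" "length w \<le> length (concat (map \<tau> w))"
    using length_concat_nonempty by auto
  show "concat (map \<tau> w) \<in> ?J"
  proof (cases "length q < length (concat (map \<tau> w))")
    case False
    then have *: "length (concat (map \<tau> w)) = length w"
      using len by linarith
    then have "concat (map \<tau> w) = map (\<lambda>i. hd (\<tau> i)) w"
      using length_concat_map_less[of \<tau> _ w] \<tau> by (intro concat_map_singletons) force
    moreover obtain \<sigma> where "w = map \<sigma> q"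
      using w False * len by auto
    ultimately show ?thesis
      by auto
  qed simp
qed

lemma map_fixes: "map \<sigma> p = p \<Longrightarrow> set p = set q \<Longrightarrow> map \<sigma> q = q"
  using map_eq_conv[of \<sigma> p id] by (auto intro: map_idI)

text \<open>Let \<open>Z\<close> be the theory of a nil variety in which the identities between different
  nonzero words are the letter-for-letter instances of \<open>u = v\<close>, and \<open>Y\<close> the theory of the join of the given variety with a nil
  variety in which \<open>v = 0\<close> and \<open>u\<close> is isolated.  Then \<open>u, v, v', u'\<close> is a chain of steps in \<open>Z\<close>,
  \<open>Y\<close>, \<open>Z\<close>.  If \<open>u = v\<close> failed in the given variety, no step of \<open>(Z \<inter> X) \<union> Y\<close> could leave the
  class of terms that denote the same semigroup word as \<open>u\<close>.\<close>

lemma upper_modular_merges: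
  assumes um: "upper_modular_theory X"
    and uu: "(u, u') \<in> X" "flat u' = None" and vv: "(v, v') \<in> X" "flat v' = None"
    and p: "flat u = Some p" and q: "flat v = Some q"
    and len: "length p = length q" and set: "set p = set q"
    and pq: "\<And>\<sigma>. map \<sigma> p \<noteq> q" "\<And>\<sigma>. map \<sigma> q \<noteq> p"
  shows "(u, v) \<in> X"
proof (rule ccontr)
  assume contra: "(u, v) \<notin> X"
  have X: "epi_theory X"
    using um by (simp add: upper_modular_theory_def)
  note fi = epi_theory_fully_invariant[OF X]
  define J where "J = {w :: nat list. length q < length w}"
  define R where "R = {(map \<sigma> p, map \<sigma> q) | \<sigma> :: nat \<Rightarrow> nat. True} \<union>
    {(map \<sigma> q, map \<sigma> p) | \<sigma> :: nat \<Rightarrow> nat. True}"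
  define J' where "J' = {w. length q < length w} \<union> {map \<sigma> q | \<sigma> :: nat \<Rightarrow> nat. True}"
  have sym: "sym R"
    by (auto simp: R_def sym_def)
  have subst: "(concat (map \<tau> (map \<sigma> p)), concat (map \<tau> (map \<sigma> q))) \<in> R \<and>
        (concat (map \<tau> (map \<sigma> q)), concat (map \<tau> (map \<sigma> p))) \<in> R \<or>
      (concat (map \<tau> (map \<sigma> p)) \<in> J \<and> concat (map \<tau> (map \<sigma> q)) \<in> J)"
    if \<tau>: "\<forall>i. \<tau> i \<noteq> []" for \<sigma> and \<tau> :: "nat \<Rightarrow> nat list"
  proof (cases "\<forall>i\<in>set (map \<sigma> p). length (\<tau> i) = 1")
    case True
    then have "concat (map \<tau> (map \<sigma> p)) = map (\<lambda>i. hd (\<tau> i)) (map \<sigma> p)"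
        "concat (map \<tau> (map \<sigma> q)) = map (\<lambda>i. hd (\<tau> i)) (map \<sigma> q)"
      using set by (auto intro!: concat_map_singletons simp del: map_map)
    then show ?thesis
      by (auto simp: R_def)
  next
    case False
    then obtain i where i: "i \<in> set (map \<sigma> p)" "i \<in> set (map \<sigma> q)" "length (\<tau> i) \<noteq> 1"
      using set by auto
    have "concat (map \<tau> w) \<in> J" if "i \<in> set w" "length w = length q" for w
      using length_concat_map_less[of \<tau> i w] \<tau> i(3) that by (simp add: J_def)
    from this[OF i(1)] this[OF i(2)] show ?thesis
      using len by simp
  qed
  have R: "top_rewriting J R"
    unfolding top_rewriting_def
  proof (intro conjI ballI sym; clarify)
    fix a b assume "(a, b) \<in> R"
    then obtain \<sigma> where ab: "a = map \<sigma> p \<and> b = map \<sigma> q \<or> a = map \<sigma> q \<and> b = map \<sigma> p"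
      by (auto simp: R_def)
    have "a \<notin> J" "set a = set b" "\<forall>c. c \<noteq> [] \<longrightarrow> a @ c \<in> J \<and> c @ a \<in> J"
      using ab len set by (auto simp: J_def)
    then show "a \<notin> J \<and> set a = set b \<and> (\<forall>c. c \<noteq> [] \<longrightarrow> a @ c \<in> J \<and> c @ a \<in> J) \<and>
        (\<forall>\<tau>. (\<forall>i. \<tau> i \<noteq> []) \<longrightarrow>
           (concat (map \<tau> a), concat (map \<tau> b)) \<in> R \<or>
           (concat (map \<tau> a) \<in> J \<and> concat (map \<tau> b) \<in> J))"
      using ab subst[of _ \<sigma>] by blast
  qed
  define Z where "Z = nil_theory J R"
  define Y where "Y = X \<inter> nil_theory J' {}"
  have Z: "epi_theory Z"
    unfolding Z_def
    by (rule epi_theory_nil_theory[where m = "length q"]) (auto simp: J_def word_ideal_long R[unfolded J_def])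
  have "epi_theory (nil_theory J' {})"
    unfolding J'_def
    by (rule epi_theory_nil_theory[OF word_ideal_instances top_rewriting_empty, where m = "length q"])
       simp
  then have Y: "epi_theory Y" "Y \<subseteq> X"
    using X by (auto simp: Y_def intro: epi_theory_Int)
  have "p \<noteq> map \<sigma> q" for \<sigma>
    using pq(2)[of \<sigma>] by blast
  then have "p \<notin> J" "q \<notin> J" "q \<in> J'" "p \<notin> J'"
    using len by (auto simp: J_def J'_def intro: exI[of _ id])
  have "(p, q) \<in> R"
    unfolding R_def by (auto intro: exI[of _ id])
  have "(u, v) \<in> Z"
    using p q \<open>p \<notin> J\<close> \<open>q \<notin> J\<close> \<open>(p, q) \<in> R\<close>
    by (auto simp: Z_def nil_theory_def term_class_def word_class_eq_iff[OF sym])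
  moreover have "(v, v') \<in> Y"
    using vv q \<open>q \<in> J'\<close> by (simp add: Y_def nil_theory_def term_class_def word_class_def)
  moreover have "(v', u') \<in> Z"
    using uu vv by (simp add: Z_def nil_theory_def term_class_def)
  ultimately have "(u, u') \<in> (Z \<union> Y)\<^sup>+"
    by (meson UnI1 UnI2 r_into_trancl trancl_into_trancl)
  then have "(u, u') \<in> ((Z \<inter> X) \<union> Y)\<^sup>+"
    using upper_modularD[OF um Y(1) Z Y(2)] uu by blast
  moreover have "flat t = Some p \<and> (u, t) \<in> X" if "(u, t) \<in> ((Z \<inter> X) \<union> Y)\<^sup>*" for t
    using that
  proof (induction rule: rtrancl_induct)
    case base
    then show ?case
      using p fully_invariant_refl[OF fi] by simp
  next
    case (step s t)
    have st: "(s, t) \<in> X"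
      using step Y by blast
    then have ut: "(u, t) \<in> X"
      using step fully_invariant_trans[OF fi] by blast
    have fs: "flat s = Some p"
      using step by blast
    show ?case
    proof (cases "(s, t) \<in> Y")
      case True
      then have "(s, t) \<in> nil_theory J' {}"
        by (simp add: Y_def)
      then obtain b where "flat t = Some b" "(p, b) \<in> {}\<^sup>*"
        using fs \<open>p \<notin> J'\<close> by (rule nil_theory_class) (auto simp: sym_def)
      then show ?thesis
        using ut by simp
    next
      case False
      then have "(s, t) \<in> nil_theory J R"
        using step by (auto simp: Z_def)
      then obtain b where b: "flat t = Some b" "(p, b) \<in> R\<^sup>*"
        using fs \<open>p \<notin> J\<close> sym by (rule nil_theory_class)
      have "b = p \<or> b = q"
        using b(2)
      proof (induction rule: rtrancl_induct)
        case (step a b)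
        then obtain \<sigma> where "a = map \<sigma> p \<and> b = map \<sigma> q \<or> a = map \<sigma> q \<and> b = map \<sigma> p"
          by (auto simp: R_def)
        then show ?case
          using step.IH pq[of \<sigma>] map_fixes[of \<sigma> p q] map_fixes[of \<sigma> q p] set by metis
      qed simp
      moreover have "b \<noteq> q"
        using same_flat_in_theory[OF X b(1)] q ut contra fully_invariant_trans[OF fi] by blast
      ultimately show ?thesis
        using ut b by simp
    qed
  qed
  ultimately show False
    using uu(2) by (force dest: trancl_into_rtrancl)
qed

text \<open>In these algebras pseudoinversion is \<open>x \<mapsto> x\<^sup>\<omega>\<close>, and it is a homomorphism onto the idempotents,
  which form a semilattice and an ideal.\<close>

locale central_absorbing = drazin_algebra S for S :: "'b unary_alg" (structure) +
  assumes central: "e \<in> carrier S \<Longrightarrow> y \<in> carrier S \<Longrightarrow> e \<cdot> e = e \<Longrightarrow> e \<cdot> y = y \<cdot> e"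
    and absorbing: "e \<in> carrier S \<Longrightarrow> y \<in> carrier S \<Longrightarrow> e \<cdot> e = e \<Longrightarrow> (e \<cdot> y) \<cdot> y = e \<cdot> y"
begin

lemma omega_absorbs:
  assumes x: "x \<in> carrier S"
  shows "omega x \<cdot> x = omega x"
proof -
  let ?e = "omega x"
  note c = x omega_closed[OF x] bar_closed[OF x]
  have xb: "x \<cdot> bar S x = ?e"
    by (simp add: omega_def)
  have "?e \<cdot> x = (?e \<cdot> ?e) \<cdot> x"
    by (simp add: omega_idempotent x)
  also have "\<dots> = (?e \<cdot> x) \<cdot> ?e"
    using assoc[OF c(2) c(2) x] assoc[OF c(2) x c(2)] omega_commute[OF x] by metis
  also have "\<dots> = ((?e \<cdot> x) \<cdot> x) \<cdot> bar S x"
    using c xb by (simp add: assoc prd_closed)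
  also have "\<dots> = (?e \<cdot> x) \<cdot> bar S x"
    using absorbing c omega_idempotent[OF x] by simp
  also have "\<dots> = ?e"
    using c xb omega_idempotent[OF x] by (simp add: assoc)
  finally show ?thesis .
qed

lemma bar_eq_omega:
  assumes x: "x \<in> carrier S"
  shows "bar S x = omega x"
proof -
  have "bar S x = (omega x \<cdot> x) \<cdot> bar S x"
    by (simp add: omega_absorbs omega_bar x)
  also have "\<dots> = omega x \<cdot> omega x"
    using assoc[OF omega_closed[OF x] x bar_closed[OF x]] by (simp add: omega_def)
  finally show ?thesis
    by (simp add: omega_idempotent x)
qed

text \<open>All positive powers of \<open>y\<close> act in the same way on idempotents, and \<open>omega y\<close> is one of them.\<close>

lemma idempotent_mult_omega:
  assumes e: "e \<in> carrier S" "e \<cdot> e = e" and y: "y \<in> carrier S"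
  shows "e \<cdot> omega y = e \<cdot> y"
proof -
  obtain n where n: "spow S y n \<cdot> omega y = spow S y n"
    using index[OF y] spow_omega_iff[OF y] by blast
  have yw: "y \<cdot> omega y = omega y"
    using omega_absorbs[OF y] omega_commute[OF y] by simp
  have "spow S y k \<cdot> omega y = omega y" for k
    by (induction k) (use y in \<open>simp_all add: assoc spow_closed omega_closed yw\<close>)
  then have "omega y = spow S y n"
    using n by simp
  moreover have "e \<cdot> spow S y k = e \<cdot> y" for k
  proof (induction k)
    case (Suc k)
    have "e \<cdot> spow S y (Suc k) = (e \<cdot> spow S y k) \<cdot> y"
      using assoc[OF e(1) spow_closed[OF y] y] by simp
    then show ?case
      using Suc absorbing[OF e(1) y e(2)] by simp
  qed simp
  ultimately show ?thesis
    by simp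
qed

lemma omega_prd:
  assumes a: "a \<in> carrier S" and b: "b \<in> carrier S"
  shows "omega (a \<cdot> b) = omega a \<cdot> omega b"
proof -
  let ?f = "omega (a \<cdot> b)" and ?g = "omega a \<cdot> omega b"
  have c: "a \<cdot> b \<in> carrier S" "?f \<in> carrier S" "omega a \<in> carrier S" "omega b \<in> carrier S" "?g \<in> carrier S"
    using a b by (simp_all add: prd_closed omega_closed)
  have comm: "omega b \<cdot> a = a \<cdot> omega b" "omega b \<cdot> omega a = omega a \<cdot> omega b"
    by (intro central c a omega_idempotent b)+
  have g: "?g \<cdot> ?g = ?g"
    using c comm omega_idempotent a b by (metis assoc)
  have f: "?f \<cdot> ?f = ?f"
    using c by (simp add: omega_idempotent)
  have "?g \<cdot> (a \<cdot> b) = (omega a \<cdot> (omega b \<cdot> a)) \<cdot> b"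
    using a b c by (simp add: assoc prd_closed)
  also have "\<dots> = (omega a \<cdot> a) \<cdot> (omega b \<cdot> b)"
    using a b c comm by (simp add: assoc prd_closed)
  finally have "?g \<cdot> ?f = ?g"
    using idempotent_mult_omega[OF c(5) g c(1)] omega_absorbs a b by simp
  moreover have "?f \<cdot> ?g = ?f"
  proof -
    have "?f = ?f \<cdot> (a \<cdot> b)"
      using omega_absorbs[OF c(1)] by simp
    also have "\<dots> = (?f \<cdot> omega a) \<cdot> b"
      using idempotent_mult_omega[OF c(2) f a] a b c by (simp add: assoc[symmetric])
    also have "\<dots> = omega a \<cdot> (?f \<cdot> b)"
      using central[OF c(2) c(3) f] b c by (simp add: assoc)
    also have "\<dots> = omega a \<cdot> (?f \<cdot> omega b)"
      using idempotent_mult_omega[OF c(2) f b] by simp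
    also have "\<dots> = (?f \<cdot> omega a) \<cdot> omega b"
      using central[OF c(2) c(3) f] c by (simp add: assoc)
    finally show ?thesis
      using c by (simp add: assoc)
  qed
  moreover have "?f \<cdot> ?g = ?g \<cdot> ?f"
    using central[OF c(2) c(5) f] .
  ultimately show ?thesis
    by simp
qed

lemma idempotent_Prd:
  assumes e: "e \<in> carrier S" "e \<cdot> e = e" and y: "y \<in> carrier S"
  shows "(e \<cdot> y) \<cdot> (e \<cdot> y) = e \<cdot> y" "(y \<cdot> e) \<cdot> (y \<cdot> e) = y \<cdot> e"
proof -
  have "(e \<cdot> y) \<cdot> (e \<cdot> y) = e \<cdot> ((y \<cdot> e) \<cdot> y)"
    using e y by (simp add: assoc prd_closed)
  also have "\<dots> = e \<cdot> ((e \<cdot> y) \<cdot> y)"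
    using central[OF e(1) y e(2)] by simp
  also have "\<dots> = e \<cdot> (e \<cdot> y)"
    using absorbing[OF e(1) y e(2)] by simp
  also have "\<dots> = e \<cdot> y"
    using assoc[OF e(1) e(1) y] e(2) by simp
  finally show *: "(e \<cdot> y) \<cdot> (e \<cdot> y) = e \<cdot> y" .
  then show "(y \<cdot> e) \<cdot> (y \<cdot> e) = y \<cdot> e"
    using central[OF e(1) y e(2)] by simp
qed

lemma idempotent_value_if_flat_None:
  assumes \<phi>: "range \<phi> \<subseteq> carrier S" and "flat u = None"
  shows "word_value S \<phi> u \<cdot> word_value S \<phi> u = word_value S \<phi> u"
  using assms(2)
proof (induction u)
  case (Prd u v)
  then show ?case
    using word_value_closed'[OF \<phi>] idempotent_Prd by (auto simp: flat_Prd_None simp del: flat.simps(2))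
next
  case (Bar u)
  then show ?case
    using word_value_closed'[OF \<phi>, of u] by (simp add: bar_eq_omega omega_idempotent)
qed simp

lemma omega_value_below_letter:
  assumes \<phi>: "range \<phi> \<subseteq> carrier S" and "i \<in> letters u"
  shows "omega (word_value S \<phi> u) \<cdot> \<phi> i = omega (word_value S \<phi> u)"
proof -
  have i: "\<phi> i \<in> carrier S"
    using \<phi> by blast
  show ?thesis
    using assms(2)
  proof (induction u)
    case (Prd u v)
    let ?u = "word_value S \<phi> u" and ?v = "word_value S \<phi> v"
    have c: "?u \<in> carrier S" "?v \<in> carrier S" "omega ?u \<in> carrier S" "omega ?v \<in> carrier S"
      using word_value_closed'[OF \<phi>] by (simp_all add: omega_closed)
    have "omega ?v \<cdot> omega ?u = omega ?u \<cdot> omega ?v"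
      using central[OF c(4,3)] c omega_idempotent by simp
    then show ?case
      using Prd c i by (auto simp: omega_prd assoc) (metis assoc)
  next
    case (Bar u)
    then show ?case
      using word_value_closed'[OF \<phi>, of u]
      by (simp add: bar_eq_omega omega_of_idempotent omega_closed omega_idempotent)
  qed (use omega_absorbs i in simp)
qed

lemma idempotent_absorbs_value:
  assumes \<phi>: "range \<phi> \<subseteq> carrier S" and f: "f \<in> carrier S" "f \<cdot> f = f"
    and "\<And>i. i \<in> letters u \<Longrightarrow> f \<cdot> \<phi> i = f"
  shows "f \<cdot> word_value S \<phi> u = f"
  using assms(4)
proof (induction u)
  case (Bar u)
  then show ?case
    using word_value_closed'[OF \<phi>, of u] idempotent_mult_omega[OF f] by (simp add: bar_eq_omega)
next
  case (Prd u v)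
  then show ?case
    using assoc[OF f(1) word_value_closed'[OF \<phi>] word_value_closed'[OF \<phi>], of u v] by simp
qed simp

lemma idempotent_values_eq:
  assumes \<phi>: "range \<phi> \<subseteq> carrier S" and letters: "letters u = letters v"
    and u: "word_value S \<phi> u \<cdot> word_value S \<phi> u = word_value S \<phi> u"
    and v: "word_value S \<phi> v \<cdot> word_value S \<phi> v = word_value S \<phi> v"
  shows "word_value S \<phi> u = word_value S \<phi> v"
proof -
  note c = word_value_closed'[OF \<phi>]
  have below: "word_value S \<phi> w \<cdot> \<phi> i = word_value S \<phi> w"
    if "word_value S \<phi> w \<cdot> word_value S \<phi> w = word_value S \<phi> w" "i \<in> letters w" for w i
    using omega_value_below_letter[OF \<phi> that(2)] omega_of_idempotent[OF c that(1)] by simp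
  have "word_value S \<phi> u \<cdot> word_value S \<phi> v = word_value S \<phi> u"
    by (rule idempotent_absorbs_value[OF \<phi> c u]) (simp add: below[OF u] letters)
  moreover have "word_value S \<phi> v \<cdot> word_value S \<phi> u = word_value S \<phi> v"
    by (rule idempotent_absorbs_value[OF \<phi> c v]) (simp add: below[OF v] flip: letters)
  ultimately show ?thesis
    using central[OF c c u] by metis
qed

text \<open>Substituting \<open>e\<close> for the letter that occurs on one side only, and \<open>f\<close> for all others, turns the
  identity into a statement that \<open>f\<close> lies below \<open>e\<close>.\<close>

lemma unique_idempotent:
  assumes sat: "satisfies S (u, v) \<or> satisfies S (v, u)" and i: "i \<in> letters u" "i \<notin> letters v"
    and e: "e \<in> carrier S" "e \<cdot> e = e" and f: "f \<in> carrier S" "f \<cdot> f = f"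
  shows "e = f"
proof -
  have "f \<cdot> e = f" if e: "e \<in> carrier S" "e \<cdot> e = e" and f: "f \<in> carrier S" "f \<cdot> f = f" for e f
  proof -
    let ?\<phi> = "(\<lambda>_. f)(i := e)"
    have \<phi>: "range ?\<phi> \<subseteq> carrier S"
      using e f by auto
    have "word_value S ?\<phi> v = f"
      using i f by (intro word_value_idempotent) auto
    then have "word_value S ?\<phi> u = f"
      using sat satisfiesD[OF _ \<phi>] by metis
    then show ?thesis
      using omega_value_below_letter[OF \<phi> i(1)] omega_of_idempotent[OF f] by simp
  qed
  from this[OF e f] this[OF f e] show ?thesis
    using central[OF e(1) f(1) e(2)] by simp
qed

end

text \<open>If \<open>n\<close> exceeds the index, \<open>x^n\<close> equals \<open>x^(n+1)\<close> times the pseudoinverse of \<open>x\<close>.  So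
  \<open>upper_modular_merges\<close> yields the identities \<open>x^n y = y x^n\<close> and \<open>x^(n+1) y = x^n y^2\<close>, which are
  evaluated at an idempotent \<open>x\<close>.  The first one needs \<open>n \<ge> 2\<close> in order that neither side be an
  instance of the other.\<close>

lemma upper_modular_models_central_absorbing:
  assumes um: "upper_modular_theory X" and S: "S \<in> models X"
  shows "central_absorbing S"
proof -
  have X: "epi_theory X"
    using um by (simp add: upper_modular_theory_def)
  note fi = epi_theory_fully_invariant[OF X]
  obtain m where "drazin_ids m \<subseteq> X"
    using X by (auto simp: epi_theory_def)
  let ?x = "Letter 0" and ?y = "Letter 1"
  let ?w = "wpow ?x (Suc m)" and ?w' = "Prd (Prd (wpow ?x (Suc m)) ?x) (Bar ?x)"
  have "drazin_ids (Suc m) \<subseteq> X"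
    using drazin_ids_mono[OF fi \<open>drazin_ids m \<subseteq> X\<close>] by simp
  then have ww: "(?w, ?w') \<in> X"
    by (auto simp: drazin_ids_def Let_def)
  have w: "flat ?w = Some (replicate (Suc (Suc m)) 0)"
    by (rule flat_wpow)
  have w': "flat ?w' = None"
    by (simp split: option.splits)
  note r = fully_invariant_refl[OF fi]
  note P = fully_invariant_Prd[OF fi]
  have commute: "(Prd ?w ?y, Prd ?y ?w) \<in> X"
  proof (rule upper_modular_merges[OF um])
    show "(Prd ?w ?y, Prd ?w' ?y) \<in> X" "(Prd ?y ?w, Prd ?y ?w') \<in> X"
      using ww r by (auto intro!: P simp del: wpow.simps)
    show "flat (Prd ?w' ?y) = None" "flat (Prd ?y ?w') = None"
      using w' by (simp_all del: wpow.simps)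
    show "flat (Prd ?w ?y) = Some (replicate (Suc (Suc m)) 0 @ [1])"
        "flat (Prd ?y ?w) = Some ([1] @ replicate (Suc (Suc m)) 0)"
      using w by (simp_all del: wpow.simps)
    show "map \<sigma> (replicate (Suc (Suc m)) 0 @ [1]) \<noteq> [1] @ replicate (Suc (Suc m)) 0"
        "map \<sigma> ([1] @ replicate (Suc (Suc m)) 0) \<noteq> replicate (Suc (Suc m)) 0 @ [1]" for \<sigma> :: "nat \<Rightarrow> nat"
      by (auto simp: replicate_append_same[symmetric])
  qed auto
  have absorb: "(Prd (Prd ?w ?x) ?y, Prd (Prd ?w ?y) ?y) \<in> X"
  proof (rule upper_modular_merges[OF um])
    show "(Prd (Prd ?w ?x) ?y, Prd (Prd ?w' ?x) ?y) \<in> X" "(Prd (Prd ?w ?y) ?y, Prd (Prd ?w' ?y) ?y) \<in> X"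
      using ww r by (auto intro!: P simp del: wpow.simps)
    show "flat (Prd (Prd ?w' ?x) ?y) = None" "flat (Prd (Prd ?w' ?y) ?y) = None"
      using w' by (simp_all del: wpow.simps)
    show "flat (Prd (Prd ?w ?x) ?y) = Some (replicate (Suc (Suc m)) 0 @ [0, 1])"
        "flat (Prd (Prd ?w ?y) ?y) = Some (replicate (Suc (Suc m)) 0 @ [1, 1])"
      using w by (simp_all del: wpow.simps)
    show "map \<sigma> (replicate (Suc (Suc m)) 0 @ [0, 1]) \<noteq> replicate (Suc (Suc m)) 0 @ [1, 1]"
        "map \<sigma> (replicate (Suc (Suc m)) 0 @ [1, 1]) \<noteq> replicate (Suc (Suc m)) 0 @ [0, 1]" for \<sigma> :: "nat \<Rightarrow> nat"
      by auto
  qed auto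
  interpret drazin_algebra S
    by (rule models_epi_theory_drazin[OF X S])
  show ?thesis
  proof
    fix e y assume e: "e \<in> carrier S" "e \<cdot>\<^bsub>S\<^esub> e = e" and y: "y \<in> carrier S"
    let ?\<phi> = "\<lambda>i :: nat. if i = 0 then e else y"
    have "range ?\<phi> \<subseteq> carrier S"
      using e y by auto
    then show "e \<cdot>\<^bsub>S\<^esub> y = y \<cdot>\<^bsub>S\<^esub> e" "(e \<cdot>\<^bsub>S\<^esub> y) \<cdot>\<^bsub>S\<^esub> y = e \<cdot>\<^bsub>S\<^esub> y"
      using satisfiesD[OF models_satisfy[OF S commute], of ?\<phi>]
        satisfiesD[OF models_satisfy[OF S absorb], of ?\<phi>] e
      by (simp_all add: word_value_wpow spow_idempotent del: wpow.simps)
  qed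
qed


section \<open>Semigroup words and affine maps\<close>

text \<open>The group of affine maps \<open>x \<mapsto> a * x + b\<close> of the rational line, with composition.\<close>

definition affine_group :: "(rat \<times> rat) unary_alg" where
  "affine_group = \<lparr>carrier = {(a, b). a \<noteq> 0},
     prd = (\<lambda>(a, b) (c, d). (a * c, a * d + b)),
     bar = (\<lambda>(a, b). (1 / a, - b / a))\<rparr>"

lemma closed_alg_affine_group: "closed_alg affine_group"
  by (auto simp: closed_alg_def affine_group_def intro: exI[of _ 1])

lemma epi_theory_affine_group: "epi_theory (theory_of {affine_group})"
  unfolding epi_theory_def
proof (intro conjI exI[of _ 0] subsetI)
  show "fully_invariant (theory_of {affine_group})"
    by (rule fully_invariant_theory_of) (simp add: closed_alg_affine_group)
  fix p assume p: "p \<in> drazin_ids 0"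
  have "word_value affine_group \<phi> (fst p) = word_value affine_group \<phi> (snd p)"
    if "range \<phi> \<subseteq> carrier affine_group" for \<phi>
  proof -
    have "\<phi> 0 \<in> carrier affine_group"
      using that by blast
    then show ?thesis
      using p by (cases "\<phi> 0"; cases "\<phi> 1"; cases "\<phi> 2")
        (auto simp: drazin_ids_def Let_def affine_group_def field_simps)
  qed
  then show "p \<in> theory_of {affine_group}"
    by (simp add: theory_of_def satisfies_def)
qed

lemma Bar_Bar_affine_group: "(u, Bar (Bar u)) \<in> theory_of {affine_group}"
proof -
  have "bar affine_group (bar affine_group g) = g" if "g \<in> carrier affine_group" for g
    using that by (auto simp: affine_group_def)
  then show ?thesis
    using word_value_closed[OF closed_alg_affine_group] by (auto simp: theory_of_def satisfies_def)
qed

lemma horner_sum_inj: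
  fixes B :: nat
  assumes "length p = length q" "\<forall>i\<in>set p. i < B" "\<forall>i\<in>set q. i < B"
    and "horner_sum (\<lambda>i. i) B p = horner_sum (\<lambda>i. i) B q"
  shows "p = q"
  using assms
proof (induction p q rule: list_induct2)
  case (Cons i p j q)
  then have "i < B" "j < B" and eq: "i + B * horner_sum (\<lambda>i. i) B p = j + B * horner_sum (\<lambda>i. i) B q"
    by auto
  have "i = (i + B * horner_sum (\<lambda>i. i) B p) mod B" "j = (j + B * horner_sum (\<lambda>i. i) B q) mod B"
    using \<open>i < B\<close> \<open>j < B\<close> by simp_all
  with eq have "i = j"
    by simp
  then show ?case
    using Cons eq \<open>i < B\<close> by auto
qed simp

text \<open>Reading a word in base \<open>B\<close> embeds the free semigroup over \<open>B\<close> letters into the affine group, so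
  the group distinguishes all semigroup words.\<close>

lemma affine_group_separates_words:
  assumes uv: "(u, v) \<in> theory_of {affine_group}" and p: "flat u = Some p" and q: "flat v = Some q"
  shows "p = q"
proof -
  define B where "B = Suc (Suc (Max (letters u \<union> letters v)))"
  have B: "i < B" if "i \<in> letters u \<union> letters v" for i
  proof -
    have "i \<le> Max (letters u \<union> letters v)"
      using that by (intro Max_ge) (auto simp: finite_letters)
    then show ?thesis
      by (simp add: B_def)
  qed
  let ?\<phi> = "\<lambda>i. (of_nat B, of_nat i) :: rat \<times> rat"
  have val: "word_value affine_group ?\<phi> w = (of_nat (B ^ length a), of_nat (horner_sum (\<lambda>i. i) B a))"
    if "flat w = Some a" for w a
    using that
  proof (induction w arbitrary: a)
    case (Letter i)
    then show ?case
      by auto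
  next
    case (Prd w w')
    then obtain a' b' where ab: "flat w = Some a'" "flat w' = Some b'" "a = a' @ b'"
      by (auto simp: flat_Prd_Some simp del: flat.simps(2))
    then show ?case
      using Prd.IH by (simp add: affine_group_def horner_sum_append power_add algebra_simps)
  qed auto
  have "range ?\<phi> \<subseteq> carrier affine_group"
    by (auto simp: affine_group_def B_def)
  then have eq: "word_value affine_group ?\<phi> u = word_value affine_group ?\<phi> v"
    using uv by (auto simp: theory_of_def satisfies_def)
  then have "B ^ length p = B ^ length q" "horner_sum (\<lambda>i. i) B p = horner_sum (\<lambda>i. i) B q"
    unfolding val[OF p] val[OF q] prod.inject of_nat_eq_iff by auto
  moreover have "1 < B"
    by (simp add: B_def)
  ultimately show ?thesis
    using B letters_flat[OF p] letters_flat[OF q] by (intro horner_sum_inj[of p q B]) auto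
qed

text \<open>In the affine group \<open>u\<close> equals its double pseudoinverse and no other semigroup word.  The chain
  leads from \<open>u\<close> to its double pseudoinverse, then by a step in \<open>Y\<close> to that of \<open>v\<close>, and on to \<open>v\<close>; as
  \<open>u\<close> is isolated in \<open>Y\<close>, the first step that leaves it is an identity of the variety and of the
  group.\<close>

lemma upper_modular_nontrivial_identity:
  assumes um: "upper_modular_theory X" and uv: "(u, v) \<in> X"
    and p: "flat u = Some p" and q: "flat v = Some q" and "p \<noteq> q"
  obtains t where "flat t = None" "(u, t) \<in> X"
proof (rule ccontr)
  assume "\<not> thesis"
  then have contra: "flat t \<noteq> None" if "(u, t) \<in> X" for t
    using that \<open>\<And>t. flat t = None \<Longrightarrow> (u, t) \<in> X \<Longrightarrow> thesis\<close> by blast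
  have X: "epi_theory X"
    using um by (simp add: upper_modular_theory_def)
  note fi = epi_theory_fully_invariant[OF X]
  define Z where "Z = theory_of {affine_group}"
  have Z: "epi_theory Z"
    by (simp add: Z_def epi_theory_affine_group)
  define J where "J = {w :: nat list. length p < length w}"
  define Y where "Y = X \<inter> nil_theory J {}"
  have "epi_theory (nil_theory J {})"
    by (rule epi_theory_nil_theory[where m = "length p"]) (auto simp: J_def word_ideal_long top_rewriting_empty)
  then have Y: "epi_theory Y" "Y \<subseteq> X"
    using X by (auto simp: Y_def intro: epi_theory_Int)
  have "(u, Bar (Bar u)) \<in> Z" "(Bar (Bar v), v) \<in> Z"
    using Bar_Bar_affine_group fully_invariant_sym[OF epi_theory_fully_invariant[OF Z]] by (auto simp: Z_def)
  moreover have "(Bar (Bar u), Bar (Bar v)) \<in> Y"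
    using uv fi by (auto simp: Y_def nil_theory_def term_class_def intro!: fully_invariant_Bar)
  ultimately have "(u, v) \<in> (Z \<union> Y)\<^sup>+"
    by (meson UnI1 UnI2 r_into_trancl trancl_into_trancl)
  then have "(u, v) \<in> ((Z \<inter> X) \<union> Y)\<^sup>+"
    using upper_modularD[OF um Y(1) Z Y(2)] uv by blast
  moreover have "flat t = Some p \<and> (u, t) \<in> X" if "(u, t) \<in> ((Z \<inter> X) \<union> Y)\<^sup>*" for t
    using that
  proof (induction rule: rtrancl_induct)
    case base
    then show ?case
      using p fully_invariant_refl[OF fi] by simp
  next
    case (step s t)
    have "(s, t) \<in> X"
      using step Y by blast
    then have ut: "(u, t) \<in> X"
      using step fully_invariant_trans[OF fi] by blast
    then obtain b where b: "flat t = Some b"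
      using contra by blast
    have fs: "flat s = Some p"
      using step by blast
    show ?case
    proof (cases "(s, t) \<in> Z")
      case True
      then show ?thesis
        using affine_group_separates_words[OF _ fs b] b ut by (auto simp: Z_def)
    next
      case False
      then have "(s, t) \<in> nil_theory J {}"
        using step by (auto simp: Y_def)
      then obtain c where "flat t = Some c" "(p, c) \<in> {}\<^sup>*"
        by (rule nil_theory_class[OF _ fs]) (auto simp: J_def sym_def)
      then show ?thesis
        using ut by simp
    qed
  qed
  ultimately show False
    using q \<open>p \<noteq> q\<close> by (force dest: trancl_into_rtrancl)
qed

section \<open>Lower-modular epigroup varieties\<close>

text \<open>These words play the role of zero, within each content.\<close>

definition idempotent_words :: "(uword \<times> uword) set \<Rightarrow> uword set" where
  "idempotent_words X = {w. (w, Prd w w) \<in> X}"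

context
  fixes X assumes um: "upper_modular_theory X"
begin

lemma X_theory: "epi_theory X"
  using um by (simp add: upper_modular_theory_def)

lemma X_invariant: "fully_invariant X"
  by (rule epi_theory_fully_invariant[OF X_theory])

lemma idempotent_words_closed:
  assumes "u \<in> idempotent_words X" "(u, v) \<in> X"
  shows "v \<in> idempotent_words X"
proof -
  have "(Prd u u, Prd v v) \<in> X"
    using assms(2) by (intro fully_invariant_Prd[OF X_invariant])
  then show ?thesis
    using assms fully_invariant_sym[OF X_invariant] fully_invariant_trans[OF X_invariant]
    unfolding idempotent_words_def mem_Collect_eq by meson
qed

lemma idempotent_words_value:
  assumes "u \<in> idempotent_words X" "S \<in> models X" "range \<phi> \<subseteq> carrier S"
  shows "word_value S \<phi> u \<cdot>\<^bsub>S\<^esub> word_value S \<phi> u = word_value S \<phi> u"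
  using satisfiesD[OF models_satisfy[OF assms(2), of u "Prd u u"] assms(3), symmetric] assms(1)
  by (simp add: idempotent_words_def)

lemma idempotent_words_if_flat_None:
  assumes "flat u = None"
  shows "u \<in> idempotent_words X"
proof -
  have "(u, Prd u u) \<in> X"
  proof (rule in_theory_if_models_satisfy[OF X_invariant])
    fix S :: "nat unary_alg" and \<phi> :: "nat \<Rightarrow> nat"
    assume S: "S \<in> models X" and \<phi>: "range \<phi> \<subseteq> carrier S"
    interpret central_absorbing S
      by (rule upper_modular_models_central_absorbing[OF um S])
    show "word_value S \<phi> u = word_value S \<phi> (Prd u u)"
      using idempotent_value_if_flat_None[OF \<phi> assms] by simp
  qed
  then show ?thesis
    by (simp add: idempotent_words_def)
qed

lemma idempotent_words_Prd:
  assumes u: "u \<in> idempotent_words X"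
  shows "Prd u v \<in> idempotent_words X \<and> Prd v u \<in> idempotent_words X"
  unfolding idempotent_words_def mem_Collect_eq
proof (intro conjI; rule in_theory_if_models_satisfy[OF X_invariant])
  fix S :: "nat unary_alg" and \<phi> :: "nat \<Rightarrow> nat"
  assume S: "S \<in> models X" and \<phi>: "range \<phi> \<subseteq> carrier S"
  interpret central_absorbing S
    by (rule upper_modular_models_central_absorbing[OF um S])
  show "word_value S \<phi> (Prd u v) = word_value S \<phi> (Prd (Prd u v) (Prd u v))"
      "word_value S \<phi> (Prd v u) = word_value S \<phi> (Prd (Prd v u) (Prd v u))"
    using idempotent_Prd[OF word_value_closed'[OF \<phi>] idempotent_words_value[OF u S \<phi>]
        word_value_closed'[OF \<phi>]] by simp_all
qed

definition idempotent_flats :: "nat list set" where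
  "idempotent_flats = {w. \<exists>u\<in>idempotent_words X. flat u = Some w}"

lemma word_ideal_idempotent_flats: "word_ideal idempotent_flats"
  unfolding word_ideal_def
proof (intro conjI ballI allI impI)
  fix w a assume "w \<in> idempotent_flats"
  then obtain u where u: "u \<in> idempotent_words X" "flat u = Some w"
    by (auto simp: idempotent_flats_def)
  have "flat (Prd (term_of a) u) = Some (a @ w)" "flat (Prd u (term_of a)) = Some (w @ a)"
    if "a \<noteq> []"
    using u flat_term_of[OF that] by auto
  then have "a @ w \<in> idempotent_flats \<and> w @ a \<in> idempotent_flats" if "a \<noteq> []"
    using idempotent_words_Prd[OF u(1)] that unfolding idempotent_flats_def by blast
  then show "a @ w \<in> idempotent_flats" "w @ a \<in> idempotent_flats"
    using u by (cases "a = []"; auto simp: idempotent_flats_def)+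
next
  fix w and \<tau> :: "nat \<Rightarrow> nat list"
  assume "w \<in> idempotent_flats" and \<tau>: "\<forall>i. \<tau> i \<noteq> []"
  then obtain u where u: "u \<in> idempotent_words X" "flat u = Some w"
    by (auto simp: idempotent_flats_def)
  then have "flat (subst (\<lambda>i. term_of (\<tau> i)) u) = Some (concat (map \<tau> w))"
    using \<tau> by (intro flat_subst_Some) (auto simp: flat_term_of)
  moreover have "subst (\<lambda>i. term_of (\<tau> i)) u \<in> idempotent_words X"
    using fully_invariant_subst[OF X_invariant, of u "Prd u u"] u(1) by (simp add: idempotent_words_def)
  ultimately show "concat (map \<tau> w) \<in> idempotent_flats"
    unfolding idempotent_flats_def by blast
qed

lemma power_in_idempotent_words: "\<exists>m. wpow (Letter 0) m \<in> idempotent_words X"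
proof -
  obtain m where m: "drazin_ids m \<subseteq> X"
    using X_theory by (auto simp: epi_theory_def)
  have "(wpow (Letter 0) m, Prd (Prd (wpow (Letter 0) m) (Letter 0)) (Bar (Letter 0))) \<in> drazin_ids m"
    by (simp add: drazin_ids_def Let_def)
  then have "(Prd (Prd (wpow (Letter 0) m) (Letter 0)) (Bar (Letter 0)), wpow (Letter 0) m) \<in> X"
    using fully_invariant_sym[OF X_invariant] m by blast
  moreover have "flat (Prd (Prd (wpow (Letter 0) m) (Letter 0)) (Bar (Letter 0))) = None"
    by (simp split: option.splits)
  ultimately show ?thesis
    using idempotent_words_closed[OF idempotent_words_if_flat_None] by blast
qed

lemma epi_theory_idempotent_flats: "epi_theory (nil_theory idempotent_flats {})"
proof -
  obtain m where m: "wpow (Letter 0) m \<in> idempotent_words X"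
    using power_in_idempotent_words by blast
  have "replicate (Suc m) 0 \<in> idempotent_flats"
    using m flat_wpow[of 0 m] unfolding idempotent_flats_def by blast
  then show ?thesis
    by (rule epi_theory_nil_theory[OF word_ideal_idempotent_flats top_rewriting_empty])
qed

lemma term_class_empty_iff: "term_class idempotent_flats {} u = {} \<longleftrightarrow> u \<in> idempotent_words X"
proof (cases "flat u")
  case None
  then show ?thesis
    using idempotent_words_if_flat_None by (simp add: term_class_def)
next
  case (Some w)
  have "w \<in> idempotent_flats \<longleftrightarrow> u \<in> idempotent_words X"
    using same_flat_in_theory[OF X_theory] idempotent_words_closed Some
    unfolding idempotent_flats_def by blast
  then show ?thesis
    using Some by (simp add: term_class_def word_class_empty_iff)
qed

lemma nil_theory_cases:
  assumes "(u, v) \<in> nil_theory idempotent_flats {}"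
  obtains "u \<in> idempotent_words X" "v \<in> idempotent_words X"
  | w where "flat u = Some w" "flat v = Some w"
proof (cases "u \<in> idempotent_words X")
  case True
  then have "v \<in> idempotent_words X"
    using assms by (simp add: nil_theory_def flip: term_class_empty_iff)
  with True that(1) show thesis
    by blast
next
  case False
  then obtain w where w: "flat u = Some w"
    using idempotent_words_if_flat_None by blast
  have "w \<notin> idempotent_flats"
    using False w term_class_empty_iff[of u] by (auto simp: term_class_def word_class_empty_iff)
  then obtain b where "flat v = Some b" "(w, b) \<in> {}\<^sup>*"
    using assms w by (elim nil_theory_class) (auto simp: sym_def)
  with w that(2) show thesis
    by simp
qed

text \<open>The nil part of the variety is defined by letting the idempotent words vanish.  It has bounded
  index because some power of a letter is idempotent.\<close>

lemma zero_reduced_nil_part: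
  "zero_reduced_variety (models (nil_theory idempotent_flats {}) :: 'a::infinite unary_alg set)"
  unfolding zero_reduced_variety_def
proof (intro conjI exI[of _ "idempotent_words X"] equalityI subsetI)
  let ?\<eta> = "nil_theory idempotent_flats {}"
  show "epigroup_variety (models ?\<eta> :: 'a unary_alg set)"
    by (rule epigroup_variety_models[OF epi_theory_idempotent_flats])
  fix S :: "'a unary_alg"
  {
    assume S: "S \<in> models ?\<eta>"
    have "p \<in> ?\<eta>" if "w \<in> idempotent_words X" "p \<in> zero_identities w" for w p
      using that idempotent_words_Prd[OF that(1)] term_class_empty_iff
      by (auto simp: zero_identities_def nil_theory_def)
    then show "S \<in> {S. epigroup_alg S \<and>
        (\<forall>w\<in>idempotent_words X. \<forall>p\<in>zero_identities w. satisfies S p)}"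
      using S models_epi_theory_drazin[OF epi_theory_idempotent_flats S]
      by (auto simp: models_def epigroup_alg_iff_drazin)
  next
    assume S: "S \<in> {S. epigroup_alg S \<and>
        (\<forall>w\<in>idempotent_words X. \<forall>p\<in>zero_identities w. satisfies S p)}"
    then interpret drazin_algebra S
      by (simp add: epigroup_alg_iff_drazin)
    let ?\<theta> = "theory_of {S}"
    have fi': "fully_invariant ?\<theta>"
      by (rule fully_invariant_theory_of) (simp add: closed_alg)
    have zero: "idempotent_words X \<subseteq> zero_words ?\<theta>"
    proof
      fix w assume "w \<in> idempotent_words X"
      then have "zero_identities w \<subseteq> ?\<theta>"
        using S by (auto simp: theory_of_def)
      then show "w \<in> zero_words ?\<theta>"
        by (simp add: zero_identities_iff[OF fi'])
    qed
    obtain m where m: "wpow (Letter 0) m \<in> idempotent_words X"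
      using power_in_idempotent_words by blast
    have "spow S x m \<cdot>\<^bsub>S\<^esub> omega x = spow S x m" if x: "x \<in> carrier S" for x
    proof -
      have "(Prd (wpow (Letter 0) m) (womega (Letter 0)), wpow (Letter 0) m) \<in> ?\<theta>"
        using m zero by (auto simp: zero_words_def)
      then have "satisfies S (Prd (wpow (Letter 0) m) (womega (Letter 0)), wpow (Letter 0) m)"
        by (simp add: theory_of_def)
      then show ?thesis
        using satisfiesD[of S _ _ "\<lambda>_. x"] x by (force simp: word_value_wpow word_value_womega)
    qed
    then have "drazin_ids m \<subseteq> ?\<theta>"
      using satisfies_drazin_ids by (auto simp: theory_of_def)
    then have \<theta>: "epi_theory ?\<theta>"
      using fi' by (auto simp: epi_theory_def)
    have "satisfies S p" if "p \<in> ?\<eta>" for p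
    proof -
      obtain u v where p: "p = (u, v)"
        by fastforce
      have "(u, v) \<in> ?\<eta>"
        using that p by simp
      then have "(u, v) \<in> ?\<theta>"
        by (cases rule: nil_theory_cases)
           (use zero zero_words_related[OF fi'] same_flat_in_theory[OF \<theta>] in blast)+
      then show ?thesis
        by (simp add: p theory_of_def)
    qed
    then show "S \<in> models ?\<eta>"
      by (auto simp: models_def closed_alg)
  }
qed

lemma subset_nil_theory: "X \<subseteq> nil_theory idempotent_flats {}"
proof (clarify)
  fix u v assume uv: "(u, v) \<in> X"
  show "(u, v) \<in> nil_theory idempotent_flats {}"
  proof (cases "u \<in> idempotent_words X")
    case True
    then have "v \<in> idempotent_words X"
      using uv idempotent_words_closed by blast
    with True show ?thesis
      by (simp add: nil_theory_def flip: term_class_empty_iff)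
  next
    case False
    then have v: "v \<notin> idempotent_words X"
      using uv idempotent_words_closed fully_invariant_sym[OF X_invariant] by blast
    obtain p q where pq: "flat u = Some p" "flat v = Some q"
      using False v idempotent_words_if_flat_None by blast
    have "p = q"
    proof (rule ccontr)
      assume "p \<noteq> q"
      then obtain t where "flat t = None" "(u, t) \<in> X"
        using upper_modular_nontrivial_identity[OF um uv pq] by blast
      then show False
        using False idempotent_words_if_flat_None idempotent_words_closed fully_invariant_sym[OF X_invariant] by blast
    qed
    then show ?thesis
      using pq by (simp add: nil_theory_def term_class_def)
  qed
qed

lemma idempotent_words_same_content:
  assumes u: "u \<in> idempotent_words X" and v: "v \<in> idempotent_words X"
    and "letters u = letters v"
  shows "(u, v) \<in> X"
proof (rule in_theory_if_models_satisfy[OF X_invariant])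
  fix S :: "nat unary_alg" and \<phi> :: "nat \<Rightarrow> nat"
  assume S: "S \<in> models X" and \<phi>: "range \<phi> \<subseteq> carrier S"
  interpret central_absorbing S
    by (rule upper_modular_models_central_absorbing[OF um S])
  show "word_value S \<phi> u = word_value S \<phi> v"
    by (rule idempotent_values_eq[OF \<phi> assms(3) idempotent_words_value[OF u S \<phi>]
          idempotent_words_value[OF v S \<phi>]])
qed

lemma idempotent_words_heterotypical:
  assumes u: "u \<in> idempotent_words X" and v: "v \<in> idempotent_words X"
    and "\<not> X \<subseteq> content_theory"
  shows "(u, v) \<in> X"
proof (rule in_theory_if_models_satisfy[OF X_invariant])
  fix S :: "nat unary_alg" and \<phi> :: "nat \<Rightarrow> nat"
  assume S: "S \<in> models X" and \<phi>: "range \<phi> \<subseteq> carrier S"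
  interpret central_absorbing S
    by (rule upper_modular_models_central_absorbing[OF um S])
  obtain a b where ab: "(a, b) \<in> X" "letters a \<noteq> letters b"
    using assms(3) by (auto simp: content_theory_def)
  then have "satisfies S (a, b)" "satisfies S (b, a)"
    using models_satisfy[OF S] fully_invariant_sym[OF X_invariant] by blast+
  moreover have "(\<exists>i. i \<in> letters a \<and> i \<notin> letters b) \<or> (\<exists>i. i \<in> letters b \<and> i \<notin> letters a)"
    using ab by blast
  ultimately show "word_value S \<phi> u = word_value S \<phi> v"
    using unique_idempotent word_value_closed'[OF \<phi>] idempotent_words_value[OF _ S \<phi>] u v by metis
qed

text \<open>An identity between words of different content makes the idempotent unique, so that the
  semilattice part is trivial.\<close>

lemma upper_modular_decomposition:
  "X = (if X \<subseteq> content_theory then content_theory else UNIV) \<inter> nil_theory idempotent_flats {}"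
proof (intro equalityI subsetI)
  fix p assume p: "p \<in> (if X \<subseteq> content_theory then content_theory else UNIV) \<inter>
    nil_theory idempotent_flats {}"
  obtain u v where uv: "p = (u, v)"
    by fastforce
  have "(u, v) \<in> nil_theory idempotent_flats {}"
    using p uv by simp
  then have "(u, v) \<in> X"
  proof (cases rule: nil_theory_cases)
    case 1
    then show ?thesis
      using p uv idempotent_words_same_content idempotent_words_heterotypical
      by (auto simp: content_theory_def split: if_splits)
  next
    case (2 w)
    then show ?thesis
      by (rule same_flat_in_theory[OF X_theory])
  qed
  then show "p \<in> X"
    by (simp add: uv)
qed (use subset_nil_theory in auto)

end

theorem theorem1p3:
  fixes \<V> :: "'a::infinite unary_alg set"
  assumes "epigroup_variety \<V>"
  shows "lower_modular EPI \<V> \<longleftrightarrow>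
         (\<exists>\<M> \<N>. (\<M> = trivial_variety \<or> \<M> = semilattice_variety) \<and>
                zero_reduced_variety \<N> \<and>
                \<V> = \<M> \<squnion>\<^bsub>EPI\<^esub> \<N>)"
proof
  assume "lower_modular EPI \<V>"
  moreover obtain X where X: "epi_theory X" "\<V> = models X"
    using epigroup_variety_theory[OF assms] by blast
  ultimately have um: "upper_modular_theory X"
    by (simp add: lower_modular_EPI_iff)
  let ?\<mu> = "if X \<subseteq> content_theory then content_theory else UNIV"
  let ?\<eta> = "nil_theory (idempotent_flats X) {}"
  have "epi_theory ?\<mu>"
    by (simp add: epi_theory_content_theory epi_theory_UNIV)
  then have "\<V> = models ?\<mu> \<squnion>\<^bsub>EPI\<^esub> models ?\<eta>"
    using X(2) upper_modular_decomposition[OF um]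
    by (simp only: join_EPI[OF _ epi_theory_idempotent_flats[OF um]])
  moreover have "(models ?\<mu> :: 'a unary_alg set) = trivial_variety \<or>
      (models ?\<mu> :: 'a unary_alg set) = semilattice_variety"
    by (simp add: trivial_variety_eq_models semilattice_variety_eq_models)
  ultimately show "\<exists>\<M> \<N>. (\<M> = trivial_variety \<or> \<M> = semilattice_variety) \<and>
      zero_reduced_variety \<N> \<and> \<V> = \<M> \<squnion>\<^bsub>EPI\<^esub> \<N>"
    using zero_reduced_nil_part[OF um] by blast
next
  assume "\<exists>\<M> \<N>. (\<M> = trivial_variety \<or> \<M> = semilattice_variety) \<and>
      zero_reduced_variety \<N> \<and> \<V> = \<M> \<squnion>\<^bsub>EPI\<^esub> \<N>"
  then obtain \<M> \<N> where \<M>: "\<M> = trivial_variety \<or> \<M> = semilattice_variety"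
    and \<N>: "zero_reduced_variety \<N>" and \<V>: "\<V> = \<M> \<squnion>\<^bsub>EPI\<^esub> \<N>"
    by blast
  obtain \<mu> where \<mu>: "\<M> = models \<mu>" "upper_modular_theory \<mu>"
    using \<M> upper_modular_UNIV upper_modular_content_theory
    by (auto simp: trivial_variety_eq_models semilattice_variety_eq_models)
  obtain \<theta> where \<theta>: "\<N> = models \<theta>" "upper_modular_theory \<theta>"
    using zero_reduced_theory[OF \<N>] upper_modular_zero_isolating by blast
  have um: "upper_modular_theory (\<mu> \<inter> \<theta>)"
    using \<mu>(2) \<theta>(2) by (rule upper_modular_theory_Int)
  have "epi_theory \<mu>" "epi_theory \<theta>" "epi_theory (\<mu> \<inter> \<theta>)"
    using \<mu>(2) \<theta>(2) um by (simp_all add: upper_modular_theory_def)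
  then show "lower_modular EPI \<V>"
    using um \<V> \<mu>(1) \<theta>(1) by (simp add: join_EPI lower_modular_EPI_iff)
qed

end
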